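(* Let $A:\mathbb R\to\mathcal M_{n\times n}(\mathbb R)$, $f:\mathbb R\times\mathbb R^n\to\mathbb R^n$, and, for some $\nu_*>0$, $g:\mathbb R\times\mathbb R^n\times[0,\nu_*]\to\mathbb R^n$, with $g_\nu(t,x):=g(t,x,\nu)$ and $g_0\equiv 0$. Assume the following. (1) $A$ is remotely almost periodic, and the system $z'=A(t)z$ has an $(\alpha,K,P)$-exponential dichotomy on $\mathbb R$ whose associated Green kernel is integrable bi-remotely almost periodic. (2) $f(t,x)$ is remotely almost periodic in $t$ uniformly with respect to $x$ in every compact subset of $\mathbb R^n$, and for every $r>0$ there is a positive constant $M(r)$ with $M(r)<\frac{\alpha}{2K}$ such that $\|f(t,x)-f(t,y)\|\le M(r)\|x-y\|$ for all $t\in\mathbb R$ and $\|x\|,\|y\|\le r$. (3) Let $\xi$ denote the unique remotely almost periodic solution of $y'=A(t)y+f(t,y)$. The function $f$ is of class $C^{2}$ in $x$, its second order derivative is locally Lipschitz in $x$, the function $t\mapsto\frac{\partial f}{\partial x}(t,\xi(t))$ is remotely almost periodic, and $\delta:=\sup_{t\in\mathbb R}\left\|\frac{\partial f}{\partial x}(t,\xi(t))\right\|<\frac{\alpha}{4K^2}$. (4) For every $r>0$, $g_\nu(t,x)$ is remotely almost periodic in $t$ uniformly for $(x,\nu)\in B_r(0)\times[0,\nu_*]$; for each fixed small $\nu$ it is uniformly bounded with respect to $x$; and for every $r>0$ and $\nu\in[0,\nu_*]$ there is a constant $M_1(r,\nu)$ with $\|g_\nu(t,x)-g_\nu(t,y)\|\le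 M_1(r,\nu)\|x-y\|$ for all $t\in\mathbb R$ and $x,y\in B[0,r]$. Moreover, for every fixed $r>0$, $\|g_\nu\|_r:=\sup_{t\in\mathbb R,\ \|x\|\le r}\|g_\nu(t,x)\|\to0$ and $M_1(r,\nu)\to0$ as $\nu\to0$. Then there exist a constant $r>0$ and a sufficiently small $\nu_0=\nu_0(r)>0$ such that, for all $\nu\in[0,\nu_0]$, the system $$\frac{dx}{dt}=A(t)x+f(t,x)+g_\nu(t,x)$$ has a unique remotely almost periodic solution $\psi_\nu$ in the $r$-neighborhood of $\xi$ (that is, with $\sup_{t\in\mathbb R}\|\psi_\nu(t)-\xi(t)\|\le r$). Also, if $g_\nu(t,x)$ is uniformly continuous for $(t,x)\in\mathbb R\times B[0,r]$ and $\nu\in[0,\nu_0]$, then $\psi_\nu(t)$ is continuous in $\nu$ and $\lim_{\nu\to0}\psi_\nu(t)=\xi(t)$.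
   Context: $\|\cdot\|$ is a fixed norm on $\mathbb R^n$ (and the induced norm on matrices). $B[0,r]$ is the closed ball and $B_r(0)$ the ball of radius $r$ centered at $0$ in $\mathbb R^n$. A bounded uniformly continuous function $u$ from $\mathbb R$ to a finite-dimensional normed space is remotely almost periodic if for every $\epsilon>0$ the set $\{\tau\in\mathbb R:\limsup_{|t|\to\infty}\|u(t+\tau)-u(t)\|<\epsilon\}$ is relatively dense in $\mathbb R$ (there is $l>0$ such that every interval of length $l$ meets it). A function $f(t,x)$ is remotely almost periodic in $t$ uniformly for $x$ in a set $W$ if it is bounded and uniformly continuous on $\mathbb R\times W$ and for every $\epsilon>0$ the set $\{\tau\in\mathbb R:\limsup_{|t|\to\infty}\sup_{x\in W}\|f(t+\tau,x)-f(t,x)\|<\epsilon\}$ is relatively dense in $\mathbb R$. The same definition is used with $x$ replaced by a pair $(x,\nu)$. The system $z'=A(t)z$, with fundamental matrix $\Phi$, $\Phi(0)=I$, has an $(\alpha,K,P)$-exponential dichotomy on $\mathbb R$ if $\alpha,K>0$ and $P$ is a projection with $\|\Phi(t)P\Phi^{-1}(s)\|\le Ke^{-\alpha(t-s)}$ for $t\ge s$ and $\|\Phi(t)(I-P)\Phi^{-1}(s)\|\le Ke^{-\alpha(s-t)}$ for $s>t$. The associated Green kernel is $G(t,s)=\Phi(t)P\Phi^{-1}(s)$ for $t\ge s$ and $G(t,s)=-\Phi(t)(I-P)\Phi^{-1}(s)$ for $t<s$. The kernel $G$ is integrable bi-remotely almost periodic if $\sup_{t}\int_{\mathbb R}\|G(t,s)\|ds<\infty$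 and for every $\epsilon>0$ the set $\{\tau\in\mathbb R:\limsup_{|t|\to\infty}\int_{\mathbb R}\|G(t+\tau,s+\tau)-G(t,s)\|\,ds<\epsilon\}$ is relatively dense in $\mathbb R$. *)

theory Defs
  imports "HOL-Analysis.Analysis"
begin

text \<open>The norm on \<open>\<real>\<^sup>n\<close> is arbitrary but fixed, so it is a parameter \<open>N\<close> and not the Euclidean
  \<^const>\<open>norm\<close>. The topological notions (continuity, boundedness, compactness, derivatives)
  do not depend on the choice of norm in finite dimension; for these the library's are used.\<close>

definition is_norm :: "('v::real_vector \<Rightarrow> real) \<Rightarrow> bool" where
  "is_norm N \<longleftrightarrow>
     (\<forall>x. N x = 0 \<longleftrightarrow> x = 0) \<and>
     (\<forall>c x. N (c *\<^sub>R x) = \<bar>c\<bar> * N x) \<and>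
     (\<forall>x y. N (x + y) \<le> N x + N y)"

definition matrix_norm :: "(real^'n \<Rightarrow> real) \<Rightarrow> real^'n^'n \<Rightarrow> real" where
  "matrix_norm N B = (SUP x\<in>{x. N x \<le> 1}. N (B *v x))"

definition relatively_dense :: "real set \<Rightarrow> bool" where
  "relatively_dense S \<longleftrightarrow> (\<exists>l>0. \<forall>a. \<exists>\<tau>\<in>S. \<tau> \<in> {a..a + l})"

text \<open>On \<^typ>\<open>real\<close>, the filter \<^const>\<open>at_infinity\<close> expresses \<open>\<bar>t\<bar> \<rightarrow> \<infinity>\<close>.\<close>

definition remotely_ap :: "('v::real_normed_vector \<Rightarrow> real) \<Rightarrow> (real \<Rightarrow> 'v) \<Rightarrow> bool" where
  "remotely_ap N u \<longleftrightarrow>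
     bounded (range u) \<and> uniformly_continuous_on UNIV u \<and>
     (\<forall>\<epsilon>>0. relatively_dense
        {\<tau>. Limsup at_infinity (\<lambda>t. ereal (N (u (t + \<tau>) - u t))) < ereal \<epsilon>})"

definition remotely_ap_uniformly ::
  "('v::real_normed_vector \<Rightarrow> real) \<Rightarrow> 'p::metric_space set \<Rightarrow> (real \<Rightarrow> 'p \<Rightarrow> 'v) \<Rightarrow> bool" where
  "remotely_ap_uniformly N W f \<longleftrightarrow>
     bounded ((\<lambda>(t, x). f t x) ` (UNIV \<times> W)) \<and>
     uniformly_continuous_on (UNIV \<times> W) (\<lambda>(t, x). f t x) \<and>
     (\<forall>\<epsilon>>0. relatively_dense
        {\<tau>. Limsup at_infinity (\<lambda>t. SUP x\<in>W. ereal (N (f (t + \<tau>) x - f t x))) < ereal \<epsilon>})"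

definition is_solution :: "(real \<Rightarrow> 'v \<Rightarrow> 'v) \<Rightarrow> (real \<Rightarrow> 'v::real_normed_vector) \<Rightarrow> bool" where
  "is_solution F x \<longleftrightarrow> (\<forall>t. (x has_vector_derivative F t (x t)) (at t))"

definition is_fundamental_matrix :: "(real \<Rightarrow> real^'n^'n) \<Rightarrow> (real \<Rightarrow> real^'n^'n) \<Rightarrow> bool" where
  "is_fundamental_matrix A \<Phi> \<longleftrightarrow>
     (\<forall>t. (\<Phi> has_vector_derivative A t ** \<Phi> t) (at t)) \<and>
     (\<forall>t. invertible (\<Phi> t)) \<and> \<Phi> 0 = mat 1"

text \<open>Dichotomy of \<open>z' = A(t) z\<close>, expressed through its fundamental matrix \<open>\<Phi>\<close>.\<close>

definition exponential_dichotomy ::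
  "(real^'n \<Rightarrow> real) \<Rightarrow> (real \<Rightarrow> real^'n^'n) \<Rightarrow> real \<Rightarrow> real \<Rightarrow> real^'n^'n \<Rightarrow> bool" where
  "exponential_dichotomy N \<Phi> \<alpha> K P \<longleftrightarrow>
     \<alpha> > 0 \<and> K > 0 \<and> P ** P = P \<and>
     (\<forall>t s. t \<ge> s \<longrightarrow>
        matrix_norm N (\<Phi> t ** P ** matrix_inv (\<Phi> s)) \<le> K * exp (- \<alpha> * (t - s))) \<and>
     (\<forall>t s. s > t \<longrightarrow>
        matrix_norm N (\<Phi> t ** (mat 1 - P) ** matrix_inv (\<Phi> s)) \<le> K * exp (- \<alpha> * (s - t)))"

definition green_kernel ::
  "(real \<Rightarrow> real^'n^'n) \<Rightarrow> real^'n^'n \<Rightarrow> real \<Rightarrow> real \<Rightarrow> real^'n^'n" where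
  "green_kernel \<Phi> P t s =
     (if t \<ge> s then \<Phi> t ** P ** matrix_inv (\<Phi> s)
      else - (\<Phi> t ** (mat 1 - P) ** matrix_inv (\<Phi> s)))"

definition integrable_bi_remotely_ap ::
  "(real^'n \<Rightarrow> real) \<Rightarrow> (real \<Rightarrow> real \<Rightarrow> real^'n^'n) \<Rightarrow> bool" where
  "integrable_bi_remotely_ap N G \<longleftrightarrow>
     (SUP t. \<integral>\<^sup>+ s. ennreal (matrix_norm N (G t s)) \<partial>lborel) < \<infinity> \<and>
     (\<forall>\<epsilon>>0. relatively_dense
        {\<tau>. Limsup at_infinity
              (\<lambda>t. \<integral>\<^sup>+ s. ennreal (matrix_norm N (G (t + \<tau>) (s + \<tau>) - G t s)) \<partial>lborel)
            < ennreal \<epsilon>})"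

end

theory Submission
  imports Defs
begin

text \<open>Testing the components of \<open>\<Phi>\<^sup>-\<^sup>1 x\<close> along \<open>P\<close> and \<open>I - P\<close> with support functionals of the norm shows that a
  bounded solution of \<open>x' = A(t) x + h(t)\<close> is bounded by \<open>(2K/\<alpha>) sup \<parallel>h\<parallel>\<close>, and near \<open>t\<close> already by the
  values of \<open>h\<close> on a long window around \<open>t\<close>. Since \<open>f + g\<^sub>\<nu>\<close> has a Lipschitz constant below \<open>\<alpha>/(2K)\<close>
  for small \<open>\<nu>\<close>, solving the linear equation is a contraction of the unit tube around \<open>\<xi>\<close>, and \<open>r = 1\<close>
  works. The window estimate, applied to \<open>x(t + \<tau>) - x(t)\<close> for a common remote almost period \<open>\<tau>\<close> of
  \<open>A\<close>, \<open>f\<close> and \<open>g\<close>, shows that the fixed point is remotely almost periodic; applied to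
  \<open>\<psi>\<^sub>\<nu> - \<psi>\<^sub>\<mu>\<close>, the global estimate gives uniqueness and continuity in \<open>\<nu>\<close>.\<close>

subsection \<open>Norms on Euclidean spaces\<close>

text \<open>The constant 2K/\<alpha> is the integral of K exp(-\<alpha>|t - s|) over all s:
  K/\<alpha> from the past for the stable part and K/\<alpha> from the future for the unstable part.
  The estimates obtain it by comparing increments with a scalar primitive, so that no vector-valued
  integral against the Green kernel has to be bounded in \<open>N\<close>. Since M(r) stays below
  \<alpha>/(2K) at every radius, the radius of the tube can be fixed in advance and only the range
  of \<nu> has to shrink: half of the gap between \<alpha>/(2K) and the Lipschitz constant of f is
  left to g. Remote almost periods say nothing about bounded t. The inhomogeneity for x(t + \<tau>)
  - x(t), which contains a multiple of that very difference, is therefore controlled only for large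
  |t|, and a supremum over all t cannot be absorbed. Instead an eventual bound is improved again and
  again, which works because the window has a length independent of t. Two relatively dense sets may
  be disjoint, so common periods have to come from the way in which sets of almost periods behave
  under subtraction.\<close>

context
  fixes N :: "'v::real_vector \<Rightarrow> real"
  assumes N: "is_norm N"
begin

lemma is_norm_zero [simp]: "N 0 = 0"
  and is_norm_eq_0: "N x = 0 \<longleftrightarrow> x = 0"
  and is_norm_scaleR: "N (c *\<^sub>R x) = \<bar>c\<bar> * N x"
  and is_norm_triangle: "N (x + y) \<le> N x + N y"
  using N unfolding is_norm_def by auto

lemma is_norm_minus: "N (- x) = N x"
  using is_norm_scaleR[of "-1" x] by simp

lemma is_norm_minus_commute: "N (x - y) = N (y - x)"
  using is_norm_minus[of "x - y"] by simp

lemma is_norm_nonneg: "0 \<le> N x"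
  using is_norm_triangle[of x "- x"] is_norm_minus[of x] by simp

lemma is_norm_triangle_diff: "N (x - y) \<le> N x + N y"
  using is_norm_triangle[of x "- y"] is_norm_minus[of y] by simp

lemma is_norm_triangle_sub: "N x \<le> N y + N (x - y)"
  using is_norm_triangle[of y "x - y"] by simp

lemma is_norm_triangle_via: "N (x - z) \<le> N (x - y) + N (y - z)"
  using is_norm_triangle[of "x - y" "y - z"] by simp

end

lemma is_norm_le_norm:
  fixes N :: "'v::euclidean_space \<Rightarrow> real"
  assumes N: "is_norm N"
  shows "\<exists>C>0. \<forall>x. N x \<le> C * norm x"
proof -
  have sum_le: "N (\<Sum>b\<in>S. f b) \<le> (\<Sum>b\<in>S. N (f b))" if "finite S" for S and f :: "'v \<Rightarrow> 'v"
    using that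
  proof (induction S)
    case (insert b S)
    then show ?case using is_norm_triangle[OF N, of "f b" "\<Sum>b\<in>S. f b"] by simp
  qed (simp add: is_norm_zero[OF N])
  \<comment> \<open>The summand 1 makes the constant visibly positive.\<close>
  have "N x \<le> (1 + (\<Sum>b\<in>Basis. N b)) * norm x" for x
  proof -
    have "N x = N (\<Sum>b\<in>Basis. (x \<bullet> b) *\<^sub>R b)" by (simp add: euclidean_representation)
    also have "\<dots> \<le> (\<Sum>b\<in>Basis. \<bar>x \<bullet> b\<bar> * N b)"
      using sum_le[of Basis "\<lambda>b. (x \<bullet> b) *\<^sub>R b"] by (simp add: is_norm_scaleR[OF N])
    also have "\<dots> \<le> (\<Sum>b\<in>Basis. norm x * N b)"
      by (intro sum_mono mult_right_mono is_norm_nonneg[OF N]) (auto simp: Basis_le_norm)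
    also have "\<dots> \<le> (1 + (\<Sum>b\<in>Basis. N b)) * norm x"
      by (simp add: algebra_simps sum_distrib_left)
    finally show ?thesis .
  qed
  moreover have "1 + (\<Sum>b\<in>Basis. N (b::'v)) > 0"
    using sum_nonneg[of Basis N] is_norm_nonneg[OF N] by (simp add: add_pos_nonneg)
  ultimately show ?thesis by blast
qed

lemma continuous_on_is_norm:
  fixes N :: "'v::euclidean_space \<Rightarrow> real"
  assumes N: "is_norm N"
  shows "continuous_on S N"
proof -
  obtain C where "C > 0" and C: "\<And>x. N x \<le> C * norm x" using is_norm_le_norm[OF N] by blast
  have "\<bar>N x - N y\<bar> \<le> C * dist x y" for x y
    using is_norm_triangle_sub[OF N, of x y] is_norm_triangle_sub[OF N, of y x]
      is_norm_minus_commute[OF N, of x y] C[of "x - y"] by (simp add: dist_norm abs_le_iff)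
  then have "C-lipschitz_on S N"
    using \<open>C > 0\<close> by (intro lipschitz_onI) (auto simp: dist_real_def)
  then show ?thesis by (rule lipschitz_on_continuous_on)
qed

text \<open>\<open>N\<close> is continuous and nonzero on the compact Euclidean unit sphere, so it
  has a positive minimum there; homogeneity carries the bound to all vectors.\<close>

lemma norm_le_is_norm:
  fixes N :: "'v::euclidean_space \<Rightarrow> real"
  assumes N: "is_norm N"
  shows "\<exists>c>0. \<forall>x. norm x \<le> c * N x"
proof -
  have "sphere (0::'v) 1 \<noteq> {}" "compact (sphere (0::'v) 1)" by auto
  then obtain x0 where x0: "x0 \<in> sphere 0 1" and le: "\<And>y. y \<in> sphere 0 1 \<Longrightarrow> N x0 \<le> N y"
    using continuous_attains_inf[OF _ _ continuous_on_is_norm[OF N]] by metis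
  have "N x0 \<noteq> 0" using x0 is_norm_eq_0[OF N, of x0] by auto
  then have pos: "N x0 > 0" using is_norm_nonneg[OF N, of x0] by simp
  have "norm x \<le> (1 / N x0) * N x" for x
  proof (cases "x = 0")
    case False
    have "N x0 \<le> N ((1 / norm x) *\<^sub>R x)" using False by (intro le) simp
    then show ?thesis using False pos by (simp add: is_norm_scaleR[OF N] field_simps)
  qed (simp add: is_norm_zero[OF N])
  then show ?thesis using pos by (intro exI[of _ "1 / N x0"]) simp
qed

lemma bounded_iff_is_norm:
  fixes N :: "'v::euclidean_space \<Rightarrow> real"
  assumes N: "is_norm N"
  shows "bounded S \<longleftrightarrow> (\<exists>B. \<forall>x\<in>S. N x \<le> B)"
proof
  assume "bounded S"
  then obtain b where b: "\<And>x. x \<in> S \<Longrightarrow> norm x \<le> b" by (auto simp: bounded_iff)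
  obtain C where "C > 0" and C: "\<And>x. N x \<le> C * norm x" using is_norm_le_norm[OF N] by blast
  have "N x \<le> C * b" if "x \<in> S" for x
    using C[of x] b[OF that] \<open>C > 0\<close> by (meson mult_left_mono order_trans less_imp_le)
  then show "\<exists>B. \<forall>x\<in>S. N x \<le> B" by blast
next
  assume "\<exists>B. \<forall>x\<in>S. N x \<le> B"
  then obtain B where B: "\<And>x. x \<in> S \<Longrightarrow> N x \<le> B" by blast
  obtain c where "c > 0" and c: "\<And>x. norm x \<le> c * N x" using norm_le_is_norm[OF N] by blast
  have "norm x \<le> c * B" if "x \<in> S" for x
    using c[of x] B[OF that] \<open>c > 0\<close> by (meson mult_left_mono order_trans less_imp_le)
  then show "bounded S" by (auto simp: bounded_iff)
qed

lemma compact_is_norm_cball: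
  fixes N :: "'v::euclidean_space \<Rightarrow> real"
  assumes N: "is_norm N"
  shows "compact {x. N x \<le> R}"
proof -
  have "closed {x. N x \<le> R}"
    using continuous_on_is_norm[OF N, of UNIV] by (intro closed_Collect_le) auto
  moreover have "bounded {x. N x \<le> R}" unfolding bounded_iff_is_norm[OF N] by blast
  ultimately show ?thesis by (simp add: compact_eq_bounded_closed)
qed

text \<open>Finite-dimensional Hahn-Banach: a hyperplane separating \<open>v\<close> from the open
  \<open>N\<close>-ball of radius \<open>N v\<close> gives the functional up to a positive
  factor.\<close>

lemma is_norm_support_functional:
  fixes N :: "'v::euclidean_space \<Rightarrow> real"
  assumes N: "is_norm N"
  shows "\<exists>a. a \<bullet> v = N v \<and> (\<forall>y. a \<bullet> y \<le> N y)"
proof (cases "v = 0")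
  case True
  then show ?thesis by (intro exI[of _ 0]) (simp add: is_norm_zero[OF N] is_norm_nonneg[OF N])
next
  case False
  then have pos: "N v > 0" using is_norm_nonneg[OF N, of v] is_norm_eq_0[OF N, of v] by linarith
  let ?S = "{y. N y < N v}"
  have "convex ?S"
  proof (rule convexI)
    fix x y and s t :: real
    assume *: "x \<in> ?S" "y \<in> ?S" "0 \<le> s" "0 \<le> t" "s + t = 1"
    have "N (s *\<^sub>R x + t *\<^sub>R y) \<le> s * N x + t * N y"
      using is_norm_triangle[OF N, of "s *\<^sub>R x" "t *\<^sub>R y"] * by (simp add: is_norm_scaleR[OF N])
    also have "\<dots> < N v"
      using * by (auto intro!: convex_bound_lt)
    finally show "s *\<^sub>R x + t *\<^sub>R y \<in> ?S" by simp
  qed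
  moreover have "?S \<noteq> {}" using pos is_norm_zero[OF N] by (auto intro: exI[of _ 0])
  ultimately obtain a b where a0: "a \<noteq> 0" and S: "\<And>x. N x < N v \<Longrightarrow> a \<bullet> x \<le> b" and b: "b \<le> a \<bullet> v"
    using separating_hyperplane_sets[of ?S "{v}"] by auto
  obtain C where "C > 0" and C: "\<And>x. N x \<le> C * norm x" using is_norm_le_norm[OF N] by blast
  \<comment> \<open>Small enough for e a to have \<open>N\<close>-norm at most N v / 2. Then e a
    lies in the ball, and the positive value of a at e a forces a to be positive at
    \<open>v\<close>.\<close>
  define e where "e = N v / (2 * C * norm a)"
  have e: "e > 0" using pos \<open>C > 0\<close> a0 by (simp add: e_def)
  have "N (e *\<^sub>R a) \<le> e * (C * norm a)"
    using e C[of a] by (simp add: is_norm_scaleR[OF N])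
  also have "\<dots> < N v" using pos \<open>C > 0\<close> a0 by (simp add: e_def)
  finally have "a \<bullet> (e *\<^sub>R a) \<le> b" by (rule S)
  moreover have "a \<bullet> (e *\<^sub>R a) > 0" using e a0 by simp
  ultimately have av: "a \<bullet> v > 0" using b by linarith
  have main: "N v * (a \<bullet> y) \<le> N y * (a \<bullet> v)" for y
  proof (cases "y = 0")
    case False
    then have y: "N y > 0" using is_norm_nonneg[OF N, of y] is_norm_eq_0[OF N, of y] by linarith
    \<comment> \<open>The factor k < 1 places the rescaled \<open>y\<close> inside the open ball;
      the bound for k = 1 follows in the limit.\<close>
    have "k * (N v * (a \<bullet> y)) \<le> N y * (a \<bullet> v)" if k: "0 < k" "k < 1" for k :: real
    proof -
      have "N ((k * N v / N y) *\<^sub>R y) = k * N v" using y k pos by (simp add: is_norm_scaleR[OF N])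
      also have "\<dots> < N v" using k pos by simp
      finally have "a \<bullet> ((k * N v / N y) *\<^sub>R y) \<le> a \<bullet> v" using S b by fastforce
      then show ?thesis using y by (simp add: field_simps)
    qed
    then show ?thesis by (rule field_le_mult_one_interval)
  qed (simp add: is_norm_zero[OF N])
  show ?thesis
  proof (intro exI[of _ "(N v / (a \<bullet> v)) *\<^sub>R a"] conjI allI)
    show "(N v / (a \<bullet> v)) *\<^sub>R a \<bullet> v = N v" using av by simp
    show "(N v / (a \<bullet> v)) *\<^sub>R a \<bullet> y \<le> N y" for y using av main[of y] by (simp add: field_simps)
  qed
qed

text \<open>Testing with a support functional of the increment reduces to the scalar mean value theorem.\<close>

lemma is_norm_increment_le:
  fixes N :: "'v::euclidean_space \<Rightarrow> real" and v v' :: "real \<Rightarrow> 'v" and \<phi> \<phi>' :: "real \<Rightarrow> real"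
  assumes N: "is_norm N" and "a \<le> b"
    and v: "\<And>s. a \<le> s \<Longrightarrow> s \<le> b \<Longrightarrow> (v has_vector_derivative v' s) (at s)"
    and \<phi>: "\<And>s. a \<le> s \<Longrightarrow> s \<le> b \<Longrightarrow> (\<phi> has_real_derivative \<phi>' s) (at s)"
    and le: "\<And>s. a < s \<Longrightarrow> s < b \<Longrightarrow> N (v' s) \<le> \<phi>' s"
  shows "N (v b - v a) \<le> \<phi> b - \<phi> a"
proof -
  obtain c where c: "c \<bullet> (v b - v a) = N (v b - v a)" and cN: "\<And>y. c \<bullet> y \<le> N y"
    using is_norm_support_functional[OF N] by blast
  let ?F = "\<lambda>s. \<phi> s - c \<bullet> v s"
  have d: "(?F has_real_derivative \<phi>' s - c \<bullet> v' s) (at s)" if "a \<le> s" "s \<le> b" for s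
    using \<phi>[OF that] bounded_linear.has_vector_derivative[OF bounded_linear_inner_right v[OF that], of c]
    by (intro DERIV_diff) (simp_all add: has_real_derivative_iff_has_vector_derivative)
  have "?F a \<le> ?F b"
  proof (rule DERIV_nonneg_imp_increasing_open[OF \<open>a \<le> b\<close>])
    show "\<exists>y. (?F has_real_derivative y) (at s) \<and> 0 \<le> y" if "a < s" "s < b" for s
      using d[of s] le[OF that] cN[of "v' s"] that by (intro exI[of _ "\<phi>' s - c \<bullet> v' s"]) auto
    show "continuous_on {a..b} ?F"
      using d by (intro DERIV_continuous_on[where D="\<lambda>s. \<phi>' s - c \<bullet> v' s"])
        (auto intro: has_field_derivative_at_within)
  qed
  then show ?thesis using c by (simp add: inner_diff_right)
qed

section \<open>The induced matrix norm, beginning with the finiteness of its defining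
  supremum\<close>

lemma matrix_norm_bdd_above:
  fixes N :: "real^'n \<Rightarrow> real" and B :: "real^'n^'n"
  assumes N: "is_norm N"
  shows "bdd_above ((\<lambda>x. N (B *v x)) ` {x. N x \<le> 1})"
proof -
  have "continuous_on {x. N x \<le> 1} (\<lambda>x. N (B *v x))"
    by (intro continuous_on_compose2[OF continuous_on_is_norm[OF N, of UNIV]] subset_UNIV
        linear_continuous_on matrix_vector_mul_bounded_linear)
  then show ?thesis
    by (intro bounded_imp_bdd_above compact_imp_bounded compact_continuous_image
        compact_is_norm_cball[OF N])
qed

lemma matrix_norm_bound:
  fixes N :: "real^'n \<Rightarrow> real" and B :: "real^'n^'n"
  assumes N: "is_norm N"
  shows "N (B *v x) \<le> matrix_norm N B * N x"
proof (cases "x = 0")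
  case False
  then have y: "N x > 0" using is_norm_nonneg[OF N, of x] is_norm_eq_0[OF N, of x] by linarith
  have "N (B *v ((1 / N x) *\<^sub>R x)) \<le> matrix_norm N B"
    unfolding matrix_norm_def
    using y by (intro cSUP_upper matrix_norm_bdd_above[OF N]) (simp add: is_norm_scaleR[OF N])
  then show ?thesis
    using y by (simp add: matrix_vector_mult_scaleR is_norm_scaleR[OF N] field_simps)
qed (simp add: is_norm_zero[OF N])

text \<open>Allows the results on an abstract norm to be applied to the matrix-valued coefficient
  \<open>A\<close> as well.\<close>

lemma is_norm_matrix_norm:
  fixes N :: "real^'n \<Rightarrow> real"
  assumes N: "is_norm N"
  shows "is_norm (matrix_norm N)"
proof -
  have ne: "{x. N x \<le> 1} \<noteq> {}" using is_norm_zero[OF N] by (auto intro: exI[of _ 0])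
  have leI: "matrix_norm N B \<le> c" if "\<And>x. N x \<le> 1 \<Longrightarrow> N (B *v x) \<le> c" for B c
    unfolding matrix_norm_def using that by (intro cSUP_least ne) auto
  have upper: "N (B *v x) \<le> matrix_norm N B" if "N x \<le> 1" for B x
    unfolding matrix_norm_def using that by (intro cSUP_upper matrix_norm_bdd_above[OF N]) auto
  have z: "matrix_norm N B = 0 \<longleftrightarrow> B = 0" for B
  proof
    assume "matrix_norm N B = 0"
    then have "B *v x = 0" for x
      using matrix_norm_bound[OF N, of B x] is_norm_nonneg[OF N, of "B *v x"]
        is_norm_eq_0[OF N, of "B *v x"] by simp
    then show "B = 0" by (simp add: matrix_eq)
  next
    assume "B = 0"
    then show "matrix_norm N B = 0"
      using leI[of B 0] upper[of 0 B] by (force simp: is_norm_zero[OF N])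
  qed
  have sc: "matrix_norm N (c *\<^sub>R B) \<le> \<bar>c\<bar> * matrix_norm N B" for c B
    using upper[of _ B]
    by (intro leI) (simp add: scaleR_matrix_vector_assoc[symmetric] is_norm_scaleR[OF N] mult_left_mono)
  \<comment> \<open>The reverse inequality is \<open>sc\<close> for the factor 1/c.\<close>
  have "matrix_norm N (c *\<^sub>R B) = \<bar>c\<bar> * matrix_norm N B" for c B
  proof (cases "c = 0")
    case False
    have "matrix_norm N B \<le> \<bar>1 / c\<bar> * matrix_norm N (c *\<^sub>R B)"
      using sc[of "1 / c" "c *\<^sub>R B"] False by simp
    then show ?thesis using sc[of c B] False by (simp add: field_simps)
  qed (simp add: z)
  moreover have "matrix_norm N (B + C) \<le> matrix_norm N B + matrix_norm N C" for B C
  proof (rule leI)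
    fix x assume x: "N x \<le> 1"
    show "N ((B + C) *v x) \<le> matrix_norm N B + matrix_norm N C"
      using is_norm_triangle[OF N, of "B *v x" "C *v x"] upper[OF x, of B] upper[OF x, of C]
      by (simp add: matrix_vector_mult_add_rdistrib)
  qed
  ultimately show ?thesis unfolding is_norm_def using z by blast
qed

subsection \<open>Linear systems with an exponential dichotomy\<close>

lemma bounded_bilinear_matrix_vector_mult:
  "bounded_bilinear ((*v) :: real^'n^'m \<Rightarrow> real^'n \<Rightarrow> real^'m)"
  unfolding bilinear_conv_bounded_bilinear[symmetric] bilinear_def
  by (auto intro!: linearI simp: matrix_vector_mult_add_rdistrib matrix_vector_right_distrib
      scaleR_matrix_vector_assoc[symmetric] matrix_vector_mult_scaleR)

lemmas has_vector_derivative_matrix_vector_mult =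
  bounded_bilinear.has_vector_derivative[OF bounded_bilinear_matrix_vector_mult]

section \<open>Inverse matrices and their continuity\<close>

lemma
  fixes B :: "real^'n^'n"
  assumes "invertible B"
  shows matrix_inv_right: "B ** matrix_inv B = mat 1"
    and matrix_inv_left: "matrix_inv B ** B = mat 1"
  using someI_ex[OF assms[unfolded invertible_def]] unfolding matrix_inv_def by auto

text \<open>Cramer's rule exhibits the inverse through quotients of polynomials in the entries, from
  which continuity can be read off.\<close>

lemma matrix_inv_cramer:
  fixes B :: "real^'n^'n"
  assumes "invertible B"
  shows "matrix_inv B *v v = (\<chi> k. det (\<chi> i j. if j = k then v $ i else B $ i $ j) / det B)"
proof -
  have "B *v (matrix_inv B *v v) = v"
    by (simp add: matrix_vector_mul_assoc matrix_inv_right[OF assms])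
  then show ?thesis using assms by (simp add: invertible_det_nz cramer)
qed

lemma continuous_on_matrix_inv_mult:
  fixes B :: "real \<Rightarrow> real^'n^'n" and v :: "real \<Rightarrow> real^'n"
  assumes "continuous_on S B" "continuous_on S v" "\<And>s. s \<in> S \<Longrightarrow> invertible (B s)"
  shows "continuous_on S (\<lambda>s. matrix_inv (B s) *v v s)"
proof -
  have det: "continuous_on S (\<lambda>s. det (C s))"
    if "\<And>i j. continuous_on S (\<lambda>s. C s $ i $ j)" for C :: "real \<Rightarrow> real^'n^'n"
    unfolding det_def by (intro continuous_intros that)
  have nz: "\<And>s. s \<in> S \<Longrightarrow> det (B s) \<noteq> 0" using assms(3) by (simp add: invertible_det_nz)
  have "continuous_on S (\<lambda>s. \<chi> k. det (\<chi> i j. if j = k then v s $ i else B s $ i $ j) / det (B s))"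
  proof (intro continuous_on_vec_lambda continuous_on_divide det)
    fix k i j :: 'n
    show "continuous_on S (\<lambda>s. (\<chi> i j. if j = k then v s $ i else B s $ i $ j) $ i $ j)"
      using assms(1,2) by (cases "j = k") (auto intro!: continuous_intros)
  qed (use nz in \<open>auto intro!: continuous_intros assms\<close>)
  then show ?thesis
    by (rule continuous_on_eq) (simp add: matrix_inv_cramer[OF assms(3)])
qed

text \<open>In this form a factor that itself depends on \<open>y\<close>, such as
  \<open>\<Psi> y\<close>, can be taken through the limit.\<close>

lemma has_vector_derivative_iff_quotient:
  "(f has_vector_derivative D) (at x) \<longleftrightarrow> ((\<lambda>y. (1 / (y - x)) *\<^sub>R (f y - f x)) \<longlongrightarrow> D) (at (x::real))"
proof -
  have "((\<lambda>y. (1 / norm (y - x)) *\<^sub>R (f y - (f x + (y - x) *\<^sub>R D))) \<longlongrightarrow> 0) (at x)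
    \<longleftrightarrow> ((\<lambda>y. (1 / (y - x)) *\<^sub>R (f y - f x) - D) \<longlongrightarrow> 0) (at x)"
  proof (subst (1 2) tendsto_norm_zero_iff[symmetric], rule filterlim_cong[OF refl refl])
    show "\<forall>\<^sub>F y in at x. norm ((1 / norm (y - x)) *\<^sub>R (f y - (f x + (y - x) *\<^sub>R D)))
      = norm ((1 / (y - x)) *\<^sub>R (f y - f x) - D)"
      unfolding eventually_at_filter
    proof (intro always_eventually allI impI)
      fix y assume "y \<noteq> x"
      then have "(1 / (y - x)) *\<^sub>R (f y - f x) - D = (1 / (y - x)) *\<^sub>R (f y - (f x + (y - x) *\<^sub>R D))"
        by (simp add: scaleR_diff_right scaleR_add_right)
      then show "norm ((1 / norm (y - x)) *\<^sub>R (f y - (f x + (y - x) *\<^sub>R D)))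
        = norm ((1 / (y - x)) *\<^sub>R (f y - f x) - D)" by simp
    qed
  qed
  then show ?thesis
    by (simp add: has_vector_derivative_def has_derivative_at2
        bounded_linear_scaleR_left LIM_zero_iff)
qed

locale dichotomic_system =
  fixes N :: "real^'n \<Rightarrow> real" and A \<Phi> :: "real \<Rightarrow> real^'n^'n" and P :: "real^'n^'n"
    and \<alpha> K :: real
  assumes N: "is_norm N"
    and fundamental: "is_fundamental_matrix A \<Phi>"
    and dichotomy: "exponential_dichotomy N \<Phi> \<alpha> K P"
begin

abbreviation \<Psi> where "\<Psi> s \<equiv> matrix_inv (\<Phi> s)"

abbreviation linear_solution :: "(real \<Rightarrow> real^'n) \<Rightarrow> (real \<Rightarrow> real^'n) \<Rightarrow> bool" where
  "linear_solution h x \<equiv> is_solution (\<lambda>t y. A t *v y + h t) x"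

lemma Phi_deriv: "(\<Phi> has_vector_derivative A t ** \<Phi> t) (at t)"
  and Phi_invertible: "invertible (\<Phi> t)"
  using fundamental unfolding is_fundamental_matrix_def by auto

lemma alpha_pos: "\<alpha> > 0" and K_pos: "K > 0" and P_idem: "P ** P = P"
  using dichotomy unfolding exponential_dichotomy_def by auto

lemma Phi_Psi [simp]: "\<Phi> t *v (\<Psi> t *v v) = v" and Psi_Phi [simp]: "\<Psi> t *v (\<Phi> t *v v) = v"
  by (simp_all add: matrix_vector_mul_assoc matrix_inv_right matrix_inv_left Phi_invertible)

lemma continuous_on_Phi: "continuous_on S \<Phi>"
  by (intro continuous_at_imp_continuous_on ballI has_vector_derivative_continuous[OF Phi_deriv])

lemma continuous_on_Psi_mult: "continuous_on S v \<Longrightarrow> continuous_on S (\<lambda>s. \<Psi> s *v v s)"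
  by (intro continuous_on_matrix_inv_mult continuous_on_Phi Phi_invertible)

lemma linear_solution_continuous: "linear_solution h x \<Longrightarrow> continuous_on S x"
  unfolding is_solution_def
  by (intro continuous_at_imp_continuous_on ballI has_vector_derivative_continuous) auto

lemma linear_solution_diff:
  assumes "linear_solution h x" "linear_solution k y"
  shows "linear_solution (\<lambda>t. h t - k t) (\<lambda>t. x t - y t)"
  unfolding is_solution_def
proof
  fix t
  have "((\<lambda>t. x t - y t) has_vector_derivative (A t *v x t + h t) - (A t *v y t + k t)) (at t)"
    using assms unfolding is_solution_def by (intro has_vector_derivative_diff) auto
  then show "((\<lambda>t. x t - y t) has_vector_derivative A t *v (x t - y t) + (h t - k t)) (at t)"
    by (simp add: matrix_vector_mult_diff_distrib algebra_simps)
qed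

text \<open>Variation of constants. The inverse need not be differentiated: with \<open>v = \<Psi> x\<close> one has
  \<open>v y - v s = \<Psi> y (x y - x s - (\<Phi> y - \<Phi> s) v s)\<close>.\<close>

lemma Psi_mult_deriv:
  assumes "linear_solution h x"
  shows "((\<lambda>s. \<Psi> s *v x s) has_vector_derivative \<Psi> s *v h s) (at s)"
  unfolding has_vector_derivative_iff_quotient
proof -
  define v where "v = \<Psi> s *v x s"
  \<comment> \<open>Both quotients have a limit containing \<open>A s *v x s\<close>, because
    \<open>\<Phi> s *v v = x s\<close>. These terms cancel, which leaves \<open>h s\<close>.\<close>
  define w where "w y = (if y = s then h s
    else (1 / (y - s)) *\<^sub>R (x y - x s) - ((1 / (y - s)) *\<^sub>R (\<Phi> y - \<Phi> s)) *v v)" for y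
  have x: "((\<lambda>y. (1 / (y - s)) *\<^sub>R (x y - x s)) \<longlongrightarrow> A s *v x s + h s) (at s)"
    using assms unfolding is_solution_def has_vector_derivative_iff_quotient by blast
  have "((\<lambda>y. ((1 / (y - s)) *\<^sub>R (\<Phi> y - \<Phi> s)) *v v) \<longlongrightarrow> (A s ** \<Phi> s) *v v) (at s)"
    using Phi_deriv[of s] unfolding has_vector_derivative_iff_quotient
    by (intro bounded_bilinear.tendsto[OF bounded_bilinear_matrix_vector_mult]) auto
  from tendsto_diff[OF x this]
  have "(w \<longlongrightarrow> h s) (at s)"
    unfolding w_def by (rule filterlim_cong[THEN iffD1, rotated -1])
      (auto simp: v_def matrix_vector_mul_assoc[symmetric] eventually_at_filter)
  then have wc: "isCont w s" by (simp add: isCont_def w_def)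
  have "((\<lambda>y. \<Psi> y *v w y) \<longlongrightarrow> \<Psi> s *v h s) (at s)"
  proof -
    have comp: "((\<lambda>y. \<Psi> y *v z) \<longlongrightarrow> \<Psi> s *v z) (at s)" for z
      using continuous_on_Psi_mult[of UNIV "\<lambda>_. z"]
      by (simp add: continuous_on_eq_continuous_at isCont_def)
    \<comment> \<open>The vector \<open>w y\<close> converges only at the point \<open>s\<close>,
      whereas continuity of \<open>\<Psi>\<close> is known after application to a vector function
      continuous on a set. Expanding in unit vectors reduces the claim to fixed vectors and scalar
      coefficients.\<close>
    have rep: "\<Psi> y *v z = (\<Sum>k\<in>UNIV. z $ k *\<^sub>R (\<Psi> y *v axis k 1))" for y and z :: "real^'n"
      by (subst basis_expansion[of z, symmetric])
        (simp add: linear_sum[OF matrix_vector_mul_linear] scalar_mult_eq_scaleR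
          matrix_vector_mult_scaleR)
    show ?thesis
      unfolding rep[of _ "w _"] rep[of s "h s"]
      by (intro tendsto_sum tendsto_scaleR comp tendsto_vec_nth \<open>(w \<longlongrightarrow> h s) (at s)\<close>)
  qed
  then show "((\<lambda>y. (1 / (y - s)) *\<^sub>R (\<Psi> y *v x y - \<Psi> s *v x s)) \<longlongrightarrow> \<Psi> s *v h s) (at s)"
  proof (rule filterlim_cong[THEN iffD1, rotated -1])
    have "\<Psi> y *v w y = (1 / (y - s)) *\<^sub>R (\<Psi> y *v x y - \<Psi> s *v x s)" if "y \<noteq> s" for y
    proof -
      have "(y - s) *\<^sub>R w y = x y - x s - (\<Phi> y - \<Phi> s) *v v"
        using that by (simp add: w_def scaleR_diff_right[of "y - s" "(1 / (y - s)) *\<^sub>R (x y - x s)"]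
              scaleR_matrix_vector_assoc)
      also have "\<dots> = x y - \<Phi> y *v v"
        by (simp add: matrix_vector_mult_diff_rdistrib v_def)
      finally have "\<Psi> y *v ((y - s) *\<^sub>R w y) = \<Psi> y *v x y - v"
        by (simp add: matrix_vector_mult_diff_distrib)
      then show ?thesis using that
        by (simp add: matrix_vector_mult_scaleR v_def[symmetric]) (metis divideR_right
            right_minus_eq inverse_eq_divide)
    qed
    then show "\<forall>\<^sub>F y in at s. \<Psi> y *v w y = (1 / (y - s)) *\<^sub>R (\<Psi> y *v x y - \<Psi> s *v x s)"
      by (auto simp: eventually_at_filter)
  qed auto
qed

text \<open>Converse direction of variation of constants; the free \<open>c\<close> will be fixed by
  boundary conditions.\<close>

lemma linear_solution_Phi_mult:
  assumes "\<And>t. (u has_vector_derivative \<Psi> t *v h t) (at t)"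
  shows "linear_solution h (\<lambda>t. \<Phi> t *v (u t + c))"
  unfolding is_solution_def
proof
  fix t
  have "((\<lambda>t. \<Phi> t *v (u t + c)) has_vector_derivative
      \<Phi> t *v (\<Psi> t *v h t + 0) + (A t ** \<Phi> t) *v (u t + c)) (at t)"
    by (intro has_vector_derivative_matrix_vector_mult has_vector_derivative_add assms
        has_vector_derivative_const Phi_deriv)
  then show "((\<lambda>t. \<Phi> t *v (u t + c)) has_vector_derivative A t *v (\<Phi> t *v (u t + c)) + h t) (at t)"
    by (simp add: matrix_vector_mul_assoc[symmetric] add.commute)
qed

text \<open>The components of a solution along \<open>P\<close> and \<open>I - P\<close>, transported from time \<open>s\<close> to time \<open>t\<close>.\<close>

definition stable :: "(real \<Rightarrow> real^'n) \<Rightarrow> real \<Rightarrow> real \<Rightarrow> real^'n" where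
  "stable x t s = (\<Phi> t ** P) *v (\<Psi> s *v x s)"

definition unstable :: "(real \<Rightarrow> real^'n) \<Rightarrow> real \<Rightarrow> real \<Rightarrow> real^'n" where
  "unstable x t s = (\<Phi> t ** (mat 1 - P)) *v (\<Psi> s *v x s)"

lemma stable_add_unstable: "stable x t t + unstable x t t = x t"
proof -
  have "stable x t t + unstable x t t = (\<Phi> t ** P + \<Phi> t ** (mat 1 - P)) *v (\<Psi> t *v x t)"
    unfolding stable_def unstable_def by (simp only: matrix_vector_mult_add_rdistrib)
  also have "\<Phi> t ** P + \<Phi> t ** (mat 1 - P) = \<Phi> t"
    by (simp add: matrix_add_ldistrib[symmetric])
  finally show ?thesis by simp
qed

section \<open>Estimates for solutions of the linear equation\<close>

lemma N_stable_mult_le: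
  assumes "s \<le> t"
  shows "N ((\<Phi> t ** P) *v (\<Psi> s *v v)) \<le> K * exp (- \<alpha> * (t - s)) * N v"
proof -
  have "N ((\<Phi> t ** P ** \<Psi> s) *v v) \<le> matrix_norm N (\<Phi> t ** P ** \<Psi> s) * N v"
    by (rule matrix_norm_bound[OF N])
  also have "\<dots> \<le> K * exp (- \<alpha> * (t - s)) * N v"
    using dichotomy assms unfolding exponential_dichotomy_def
    by (intro mult_right_mono is_norm_nonneg[OF N]) auto
  finally show ?thesis by (simp add: matrix_vector_mul_assoc)
qed

lemma N_unstable_mult_le:
  assumes "t < s"
  shows "N ((\<Phi> t ** (mat 1 - P)) *v (\<Psi> s *v v)) \<le> K * exp (- \<alpha> * (s - t)) * N v"
proof -
  have "N ((\<Phi> t ** (mat 1 - P) ** \<Psi> s) *v v) \<le> matrix_norm N (\<Phi> t ** (mat 1 - P) ** \<Psi> s) * N v"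
    by (rule matrix_norm_bound[OF N])
  also have "\<dots> \<le> K * exp (- \<alpha> * (s - t)) * N v"
    using dichotomy assms unfolding exponential_dichotomy_def
    by (intro mult_right_mono is_norm_nonneg[OF N]) auto
  finally show ?thesis by (simp add: matrix_vector_mul_assoc)
qed

text \<open>The stable component is followed forward from the earlier time \<open>T\<close>. The
  forcing in between contributes at most the integral of K \<eta> exp(-\<alpha>(t - s)), expressed
  as an increment of its primitive.\<close>

lemma stable_estimate:
  assumes x: "linear_solution h x" and "T \<le> t" and h: "\<And>s. T \<le> s \<Longrightarrow> s \<le> t \<Longrightarrow> N (h s) \<le> \<eta>"
  shows "N (stable x t t) \<le> N (stable x t T) + K * \<eta> / \<alpha>"
proof -
  have \<eta>: "\<eta> \<ge> 0" using h[of t] is_norm_nonneg[OF N, of "h t"] \<open>T \<le> t\<close> by simp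
  let ?\<phi> = "\<lambda>s. K * \<eta> / \<alpha> * exp (- \<alpha> * (t - s))"
  have "N (stable x t t - stable x t T) \<le> ?\<phi> t - ?\<phi> T"
  proof (rule is_norm_increment_le[OF N \<open>T \<le> t\<close>])
    fix s
    show "(stable x t has_vector_derivative (\<Phi> t ** P) *v (\<Psi> s *v h s)) (at s)"
      unfolding stable_def[abs_def]
      by (rule bounded_linear.has_vector_derivative[OF matrix_vector_mul_bounded_linear
            Psi_mult_deriv[OF x]])
    show "(?\<phi> has_real_derivative K * \<eta> * exp (- \<alpha> * (t - s))) (at s)"
      using alpha_pos by (auto intro!: derivative_eq_intros simp: field_simps)
    assume s: "T < s" "s < t"
    have "N ((\<Phi> t ** P) *v (\<Psi> s *v h s)) \<le> K * exp (- \<alpha> * (t - s)) * N (h s)"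
      using N_stable_mult_le s by simp
    also have "\<dots> \<le> K * exp (- \<alpha> * (t - s)) * \<eta>"
      using h[of s] s K_pos by (intro mult_left_mono) auto
    finally show "N ((\<Phi> t ** P) *v (\<Psi> s *v h s)) \<le> K * \<eta> * exp (- \<alpha> * (t - s))"
      by (simp add: mult_ac)
  qed
  also have "\<dots> \<le> K * \<eta> / \<alpha>" using \<eta> K_pos alpha_pos by simp
  finally show ?thesis using is_norm_triangle_sub[OF N, of "stable x t t" "stable x t T"] by simp
qed

text \<open>Time reversal of \<open>stable_estimate\<close>: the unstable component is controlled
  from the later time \<open>T\<close>, and the sign of the primitive changes accordingly.\<close>

lemma unstable_estimate:
  assumes x: "linear_solution h x" and "t \<le> T" and h: "\<And>s. t \<le> s \<Longrightarrow> s \<le> T \<Longrightarrow> N (h s) \<le> \<eta>"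
  shows "N (unstable x t t) \<le> N (unstable x t T) + K * \<eta> / \<alpha>"
proof -
  have \<eta>: "\<eta> \<ge> 0" using h[of t] is_norm_nonneg[OF N, of "h t"] \<open>t \<le> T\<close> by simp
  let ?\<phi> = "\<lambda>s. - (K * \<eta> / \<alpha> * exp (- \<alpha> * (s - t)))"
  have "N (unstable x t T - unstable x t t) \<le> ?\<phi> T - ?\<phi> t"
  proof (rule is_norm_increment_le[OF N \<open>t \<le> T\<close>])
    fix s
    show "(unstable x t has_vector_derivative (\<Phi> t ** (mat 1 - P)) *v (\<Psi> s *v h s)) (at s)"
      unfolding unstable_def[abs_def]
      by (rule bounded_linear.has_vector_derivative[OF matrix_vector_mul_bounded_linear
            Psi_mult_deriv[OF x]])
    show "(?\<phi> has_real_derivative K * \<eta> * exp (- \<alpha> * (s - t))) (at s)"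
      using alpha_pos by (auto intro!: derivative_eq_intros simp: field_simps)
    \<comment> \<open>The open interval matters: the dichotomy bounds this part only for s strictly
      after t.\<close>
    assume s: "t < s" "s < T"
    have "N ((\<Phi> t ** (mat 1 - P)) *v (\<Psi> s *v h s)) \<le> K * exp (- \<alpha> * (s - t)) * N (h s)"
      using N_unstable_mult_le s by simp
    also have "\<dots> \<le> K * exp (- \<alpha> * (s - t)) * \<eta>"
      using h[of s] s K_pos by (intro mult_left_mono) auto
    finally show "N ((\<Phi> t ** (mat 1 - P)) *v (\<Psi> s *v h s)) \<le> K * \<eta> * exp (- \<alpha> * (s - t))"
      by (simp add: mult_ac)
  qed
  also have "\<dots> \<le> K * \<eta> / \<alpha>" using \<eta> K_pos alpha_pos by simp
  finally show ?thesis
    using is_norm_triangle_sub[OF N, of "unstable x t t" "unstable x t T"]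
      is_norm_minus_commute[OF N, of "unstable x t t" "unstable x t T"] by simp
qed

text \<open>The stable part is traced back to t - T and the unstable part to t + T. Each boundary
  value is damped by exp(-\<alpha>T), and each half of the window contributes K\<eta>/\<alpha>. Only
  values of \<open>h\<close> inside the window enter.\<close>

lemma window_estimate:
  assumes x: "linear_solution h x" and "T > 0"
    and h: "\<And>s. \<bar>s - t\<bar> \<le> T \<Longrightarrow> N (h s) \<le> \<eta>" and B: "N (x (t - T)) \<le> B" "N (x (t + T)) \<le> B"
  shows "N (x t) \<le> 2 * K * exp (- \<alpha> * T) * B + 2 * K / \<alpha> * \<eta>"
proof -
  have 1: "N (stable x t t) \<le> N (stable x t (t - T)) + K * \<eta> / \<alpha>"
    using \<open>T > 0\<close> by (intro stable_estimate[OF x] h) auto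
  have 2: "N (unstable x t t) \<le> N (unstable x t (t + T)) + K * \<eta> / \<alpha>"
    using \<open>T > 0\<close> by (intro unstable_estimate[OF x] h) auto
  have "N (stable x t (t - T)) \<le> K * exp (- \<alpha> * T) * N (x (t - T))"
    unfolding stable_def using N_stable_mult_le[of "t - T" t] \<open>T > 0\<close> by simp
  also have "\<dots> \<le> K * exp (- \<alpha> * T) * B" using B K_pos by (intro mult_left_mono) auto
  finally have 3: "N (stable x t (t - T)) \<le> K * exp (- \<alpha> * T) * B" .
  have "N (unstable x t (t + T)) \<le> K * exp (- \<alpha> * T) * N (x (t + T))"
    unfolding unstable_def using N_unstable_mult_le[of t "t + T"] \<open>T > 0\<close> by simp
  also have "\<dots> \<le> K * exp (- \<alpha> * T) * B" using B K_pos by (intro mult_left_mono) auto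
  finally have 4: "N (unstable x t (t + T)) \<le> K * exp (- \<alpha> * T) * B" .
  show ?thesis
    using 1 2 3 4 is_norm_triangle[OF N, of "stable x t t" "unstable x t t"]
    by (simp add: stable_add_unstable)
qed

lemma exp_decay_small:
  assumes "\<epsilon> > 0"
  obtains T where "T > 0" "2 * K * exp (- \<alpha> * T) * B < \<epsilon>"
proof -
  have "filterlim (\<lambda>T. - \<alpha> * T) at_bot at_top"
    using alpha_pos
    by (intro filterlim_tendsto_neg_mult_at_bot[OF tendsto_const _ filterlim_ident]) simp
  then have "((\<lambda>T. exp (- \<alpha> * T)) \<longlongrightarrow> 0) at_top"
    by (rule filterlim_compose[OF exp_at_bot])
  then have "((\<lambda>T. 2 * K * exp (- \<alpha> * T) * B) \<longlongrightarrow> 0) at_top"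
    by (intro tendsto_mult_left_zero tendsto_mult_right_zero)
  then have "\<forall>\<^sub>F T in at_top. 2 * K * exp (- \<alpha> * T) * B < \<epsilon>" using assms order_tendstoD(2) by blast
  then have "\<forall>\<^sub>F T in at_top. T > 0 \<and> 2 * K * exp (- \<alpha> * T) * B < \<epsilon>"
    using eventually_gt_at_top[of 0] by eventually_elim auto
  from eventually_happens'[OF _ this] show thesis using that by auto
qed

text \<open>As the window grows, the boundary term disappears because the solution is
  bounded.\<close>

lemma bounded_solution_estimate:
  assumes x: "linear_solution h x" and B: "\<And>t. N (x t) \<le> B" and h: "\<And>t. N (h t) \<le> \<eta>"
  shows "N (x t) \<le> 2 * K / \<alpha> * \<eta>"
proof (rule field_le_epsilon)
  fix e :: real assume "e > 0"
  then obtain T where "T > 0" "2 * K * exp (- \<alpha> * T) * B < e" by (rule exp_decay_small)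
  moreover have "N (x t) \<le> 2 * K * exp (- \<alpha> * T) * B + 2 * K / \<alpha> * \<eta>"
    by (rule window_estimate[OF x \<open>T > 0\<close> h B B])
  ultimately show "N (x t) \<le> 2 * K / \<alpha> * \<eta> + e" by linarith
qed

text \<open>The bounded solution is the limit of the solutions on \<open>[-n, n]\<close> with vanishing stable part
  at \<open>-n\<close> and vanishing unstable part at \<open>n\<close>.\<close>

lemma bounded_solution_exists:
  assumes h: "continuous_on UNIV h" and H: "\<And>t. N (h t) \<le> H"
  shows "\<exists>x. linear_solution h x \<and> (\<forall>t. N (x t) \<le> 2 * K / \<alpha> * H)"
proof -
  have "\<exists>u. \<forall>t. -\<infinity> < ereal t \<longrightarrow> ereal t < \<infinity> \<longrightarrow> (u has_vector_derivative \<Psi> t *v h t) (at t)"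
    using continuous_on_Psi_mult[OF h]
    by (intro einterval_antiderivative) (simp_all add: continuous_on_eq_continuous_at)
  then obtain u where u: "\<And>t. (u has_vector_derivative \<Psi> t *v h t) (at t)" by auto
  \<comment> \<open>Forced by \<open>P *v (u (- n) + c n) = 0\<close> and
    \<open>(mat 1 - P) *v (u n + c n) = 0\<close>, since \<open>P\<close> and
    \<open>mat 1 - P\<close> are complementary projections.\<close>
  define c where "c n = - (P *v u (- n)) - (mat 1 - P) *v u n" for n :: real
  define x where "x n t = \<Phi> t *v (u t + c n)" for n t
  have sol: "linear_solution h (x n)" for n
    unfolding x_def[abs_def] by (rule linear_solution_Phi_mult[OF u])
  have PP: "P *v (P *v v) = P *v v" for v
    using P_idem by (simp add: matrix_vector_mul_assoc)
  have "P *v (u (- n) + c n) = 0" "(mat 1 - P) *v (u n + c n) = 0" for n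
    unfolding c_def
    by (simp_all add: matrix_vector_right_distrib matrix_vector_mult_diff_distrib
        matrix_vector_mult_diff_rdistrib PP linear_neg[OF matrix_vector_mul_linear])
  then have bc: "stable (x n) t (- n) = 0" "unstable (x n) t n = 0" for n t
    by (simp_all add: stable_def unstable_def x_def matrix_vector_mul_assoc[symmetric])
  have bd: "N (x n t) \<le> 2 * K / \<alpha> * H" if "\<bar>t\<bar> \<le> n" for n t
  proof -
    have "N (stable (x n) t t) \<le> 0 + K * H / \<alpha>"
      using stable_estimate[OF sol[of n] _ H, of "- n" t] that by (simp add: bc is_norm_zero[OF N])
    moreover have "N (unstable (x n) t t) \<le> 0 + K * H / \<alpha>"
      using unstable_estimate[OF sol[of n] _ H, of t n] that by (simp add: bc is_norm_zero[OF N])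
    moreover have "2 * K / \<alpha> * H = K * H / \<alpha> + K * H / \<alpha>" by (simp add: field_simps)
    ultimately show ?thesis
      using is_norm_triangle[OF N, of "stable (x n) t t" "unstable (x n) t t"]
      unfolding stable_add_unstable by linarith
  qed
  have "H \<ge> 0" using H[of 0] is_norm_nonneg[OF N, of "h 0"] by linarith
  \<comment> \<open>The difference of two approximations solves the homogeneous equation and is
    bounded on [-n, n], hence exponentially small at 0. There it equals the difference of the
    constants, because \<open>\<Phi> 0\<close> is the identity.\<close>
  have cauchy: "N (c m - c n) \<le> 2 * K * exp (- \<alpha> * n) * (2 * (2 * K / \<alpha> * H))" if "0 < n" "n \<le> m" for m n
  proof -
    have d: "linear_solution (\<lambda>t. 0) (\<lambda>t. x m t - x n t)"
      using linear_solution_diff[OF sol[of m] sol[of n]] by simp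
    have "N (x m t - x n t) \<le> 2 * (2 * K / \<alpha> * H)" if "\<bar>t\<bar> \<le> n" for t
      using add_mono[OF bd[of t m] bd[of t n]] that \<open>n \<le> m\<close>
        is_norm_triangle_diff[OF N, of "x m t" "x n t"] unfolding mult_2 by (auto intro: order_trans)
    then have "N (x m 0 - x n 0) \<le> 2 * K * exp (- \<alpha> * n) * (2 * (2 * K / \<alpha> * H)) + 2 * K / \<alpha> * 0"
      using that by (intro window_estimate[OF d]) (auto simp: is_norm_zero[OF N])
    moreover have "x m 0 - x n 0 = c m - c n"
      using fundamental by (simp add: x_def is_fundamental_matrix_def)
    ultimately show ?thesis by simp
  qed
  obtain k where "k > 0" and k: "\<And>x. norm x \<le> k * N x" using norm_le_is_norm[OF N] by blast
  have "Cauchy (\<lambda>n. c (real n))"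
  proof (rule metric_CauchyI)
    fix e :: real assume "e > 0"
    then have "e / k > 0" using \<open>k > 0\<close> by simp
    then obtain T where T: "T > 0" "2 * K * exp (- \<alpha> * T) * (2 * (2 * K / \<alpha> * H)) < e / k"
      by (rule exp_decay_small)
    have *: "norm (c (real m) - c (real n)) < e" if "nat \<lceil>T\<rceil> \<le> n" "n \<le> m" for m n
    proof -
      have "T \<le> n" using that by linarith
      have "norm (c m - c n) \<le> k * N (c m - c n)" by (rule k)
      also have "\<dots> \<le> k * (2 * K * exp (- \<alpha> * n) * (2 * (2 * K / \<alpha> * H)))"
        using that \<open>T \<le> n\<close> T(1) \<open>k > 0\<close> by (intro mult_left_mono cauchy) auto
      also have "\<dots> \<le> k * (2 * K * exp (- \<alpha> * T) * (2 * (2 * K / \<alpha> * H)))"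
        using \<open>T \<le> n\<close> \<open>k > 0\<close> K_pos alpha_pos \<open>H \<ge> 0\<close>
        by (intro mult_left_mono mult_right_mono) auto
      also have "\<dots> < e" using T(2) \<open>k > 0\<close> by (simp add: field_simps)
      finally show ?thesis .
    qed
    have "dist (c (real m)) (c (real n)) < e" if "m \<ge> nat \<lceil>T\<rceil>" "n \<ge> nat \<lceil>T\<rceil>" for m n
      using *[of m n] *[of n m] that by (cases "n \<le> m") (auto simp: dist_norm norm_minus_commute)
    then show "\<exists>M. \<forall>m\<ge>M. \<forall>n\<ge>M. dist (c (real m)) (c (real n)) < e" by blast
  qed
  then obtain c0 where c0: "(\<lambda>n. c (real n)) \<longlonglongrightarrow> c0"
    using Cauchy_convergent_iff convergent_def by blast
  define y where "y t = \<Phi> t *v (u t + c0)" for t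
  have "N (y t) \<le> 2 * K / \<alpha> * H" for t
  proof (rule tendsto_upperbound)
    have "(\<lambda>n. \<Phi> t *v (u t + c (real n))) \<longlonglongrightarrow> \<Phi> t *v (u t + c0)"
      by (intro bounded_linear.tendsto[OF matrix_vector_mul_bounded_linear] tendsto_intros c0)
    then show "(\<lambda>n. N (x (real n) t)) \<longlonglongrightarrow> N (y t)"
      unfolding x_def y_def
      using continuous_on_tendsto_compose[OF continuous_on_is_norm[OF N, of UNIV]] by fastforce
    show "\<forall>\<^sub>F n in sequentially. N (x (real n) t) \<le> 2 * K / \<alpha> * H"
      using eventually_ge_at_top[of "nat \<lceil>\<bar>t\<bar>\<rceil>"] by eventually_elim (intro bd, linarith)
  qed simp
  moreover have "linear_solution h y"
    unfolding y_def[abs_def] by (rule linear_solution_Phi_mult[OF u])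
  ultimately show ?thesis by blast
qed

end

subsection \<open>Common remote almost periods\<close>

text \<open>An eventual inequality follows from the condition on the Limsup and is easier to shift
  in time and to intersect.\<close>

definition remote_periods ::
  "('v::real_vector \<Rightarrow> real) \<Rightarrow> 'p set \<Rightarrow> (real \<Rightarrow> 'p \<Rightarrow> 'v) \<Rightarrow> real \<Rightarrow> real set" where
  "remote_periods N W f \<epsilon> = {\<tau>. \<forall>\<^sub>F t in at_infinity. \<forall>x\<in>W. N (f (t + \<tau>) x - f t x) < \<epsilon>}"

text \<open>What Bohr's argument for common almost periods needs of the sets of \<open>\<epsilon>\<close>-almost periods.\<close>

definition almost_period_family :: "(real \<Rightarrow> real set) \<Rightarrow> bool" where
  "almost_period_family S \<longleftrightarrow>
     (\<forall>\<epsilon>>0. relatively_dense (S \<epsilon>)) \<and>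
     (\<forall>\<epsilon>>0. \<exists>\<eta>>0. {-\<eta>..\<eta>} \<subseteq> S \<epsilon>) \<and>
     (\<forall>\<epsilon> \<delta> \<tau> \<sigma>. \<tau> \<in> S \<epsilon> \<longrightarrow> \<sigma> \<in> S \<delta> \<longrightarrow> \<tau> - \<sigma> \<in> S (\<epsilon> + \<delta>))"

lemma relatively_dense_mono: "relatively_dense S \<Longrightarrow> S \<subseteq> T \<Longrightarrow> relatively_dense T"
  unfolding relatively_dense_def by blast

lemma eventually_at_infinity_shift:
  fixes c :: real
  assumes "\<forall>\<^sub>F t in at_infinity. Q t"
  shows "\<forall>\<^sub>F t in at_infinity. Q (t + c)"
proof -
  obtain b where b: "\<And>t. b \<le> \<bar>t\<bar> \<Longrightarrow> Q t" using assms by (auto simp: eventually_at_infinity)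
  have "Q (t + c)" if "b + \<bar>c\<bar> \<le> \<bar>t\<bar>" for t using that by (intro b) linarith
  then show ?thesis unfolding eventually_at_infinity by auto
qed

text \<open>Subtract the period 0, which belongs to the set for the positive tolerance \<delta> -
  \<epsilon>; the tolerances add up to \<delta>.\<close>

lemma almost_period_family_mono:
  assumes S: "almost_period_family S" and \<tau>: "\<tau> \<in> S \<epsilon>" and "\<epsilon> \<le> \<delta>"
  shows "\<tau> \<in> S \<delta>"
proof (cases "\<epsilon> = \<delta>")
  case False
  then obtain \<eta> where "\<eta> > 0" "{-\<eta>..\<eta>} \<subseteq> S (\<delta> - \<epsilon>)"
    using S \<open>\<epsilon> \<le> \<delta>\<close> unfolding almost_period_family_def by (metis diff_gt_0_iff_gt order_less_le)
  then have "0 \<in> S (\<delta> - \<epsilon>)" by auto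
  then have "\<tau> - 0 \<in> S (\<epsilon> + (\<delta> - \<epsilon>))" using S \<tau> unfolding almost_period_family_def by blast
  then show ?thesis by simp
qed (use \<tau> in simp)

text \<open>Bohr's argument: pick \<open>\<tau>\<^sub>i a \<in> S\<^sub>i\<close> in \<open>[a, a + l]\<close>. The differences \<open>\<tau>\<^sub>1 a - \<tau>\<^sub>2 a\<close> lie in
  \<open>[-l, l]\<close>, so up to \<open>\<eta>\<close> they take finitely many values, each represented by some \<open>c\<close>; and
  \<open>\<tau>\<^sub>1 a - \<tau>\<^sub>1 c\<close> is then, up to \<open>\<eta>\<close>, also \<open>\<tau>\<^sub>2 a - \<tau>\<^sub>2 c\<close>.\<close>

lemma almost_period_family_Int:
  assumes S1: "almost_period_family S1" and S2: "almost_period_family S2"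
  shows "almost_period_family (\<lambda>\<epsilon>. S1 \<epsilon> \<inter> S2 \<epsilon>)"
proof -
  have dense: "relatively_dense (S1 \<epsilon> \<inter> S2 \<epsilon>)" if "\<epsilon> > 0" for \<epsilon>
  proof -
    \<comment> \<open>A difference of two periods costs 2e and the correction \<rho> one more e,
      within \<epsilon> in total.\<close>
    define e where "e = \<epsilon> / 4"
    have "e > 0" using that by (simp add: e_def)
    obtain l1 where "l1 > 0" and l1: "\<And>a. \<exists>\<tau>\<in>S1 e. \<tau> \<in> {a..a + l1}"
      using S1 \<open>e > 0\<close> unfolding almost_period_family_def relatively_dense_def by meson
    obtain l2 where "l2 > 0" and l2: "\<And>a. \<exists>\<tau>\<in>S2 e. \<tau> \<in> {a..a + l2}"
      using S2 \<open>e > 0\<close> unfolding almost_period_family_def relatively_dense_def by meson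
    obtain \<eta> where "\<eta> > 0" and \<eta>: "{-\<eta>..\<eta>} \<subseteq> S2 e"
      using S2 \<open>e > 0\<close> unfolding almost_period_family_def by meson
    define l where "l = max l1 l2"
    have "\<exists>\<tau>\<in>S1 e. \<tau> \<in> {a..a + l}" for a using l1[of a] unfolding l_def by fastforce
    then obtain \<tau>1 where \<tau>1: "\<And>a. \<tau>1 a \<in> S1 e" "\<And>a. \<tau>1 a \<in> {a..a + l}" by metis
    have "\<exists>\<tau>\<in>S2 e. \<tau> \<in> {a..a + l}" for a using l2[of a] unfolding l_def by fastforce
    then obtain \<tau>2 where \<tau>2: "\<And>a. \<tau>2 a \<in> S2 e" "\<And>a. \<tau>2 a \<in> {a..a + l}" by metis
    define k where "k a = \<lfloor>(\<tau>1 a - \<tau>2 a) / \<eta>\<rfloor>" for a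
    have "range k \<subseteq> {\<lfloor>- l / \<eta>\<rfloor>..\<lfloor>l / \<eta>\<rfloor>}"
    proof (rule image_subsetI)
      fix a
      have "- l \<le> \<tau>1 a - \<tau>2 a" "\<tau>1 a - \<tau>2 a \<le> l" using \<tau>1(2)[of a] \<tau>2(2)[of a] by auto
      then show "k a \<in> {\<lfloor>- l / \<eta>\<rfloor>..\<lfloor>l / \<eta>\<rfloor>}"
        unfolding k_def atLeastAtMost_iff using \<open>\<eta> > 0\<close>
        by (intro conjI floor_mono divide_right_mono) auto
    qed
    then have fin: "finite (range k)" by (rule finite_subset) simp
    define rep where "rep = inv k"
    have rep: "k (rep (k a)) = k a" for a unfolding rep_def by (rule f_inv_into_f[OF rangeI])
    \<comment> \<open>Finitely many cells have finitely many representatives, so their periods are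
      bounded. Subtracting one moves a period by at most C; the start a' + C below keeps the result
      to the right of a'.\<close>
    define C where "C = Max ((\<lambda>j. \<bar>\<tau>1 (rep j)\<bar>) ` range k)"
    have C: "\<bar>\<tau>1 (rep (k a))\<bar> \<le> C" for a
      unfolding C_def using fin by (intro Max_ge) auto
    have "C \<ge> 0" using C[of 0] by linarith
    have "\<exists>\<tau>\<in>S1 \<epsilon> \<inter> S2 \<epsilon>. \<tau> \<in> {a'..a' + (l + 2 * C)}" for a'
    proof -
      define a where "a = a' + C"
      define c where "c = rep (k a)"
      define \<rho> where "\<rho> = (\<tau>2 a - \<tau>2 c) - (\<tau>1 a - \<tau>1 c)"
      have "k a = k c" unfolding c_def by (simp add: rep)
      then have "\<bar>(\<tau>1 a - \<tau>2 a) / \<eta> - (\<tau>1 c - \<tau>2 c) / \<eta>\<bar> \<le> 1" unfolding k_def by linarith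
      then have "\<bar>(\<tau>1 a - \<tau>2 a) - (\<tau>1 c - \<tau>2 c)\<bar> \<le> \<eta>"
        using \<open>\<eta> > 0\<close> by (simp add: diff_divide_distrib[symmetric] abs_divide)
      then have "\<rho> \<in> {-\<eta>..\<eta>}" unfolding \<rho>_def by (auto simp: abs_le_iff)
      then have "\<rho> \<in> S2 e" using \<eta> by blast
      moreover have "\<tau>2 a - \<tau>2 c \<in> S2 (e + e)"
        using S2 \<tau>2(1) unfolding almost_period_family_def by blast
      ultimately have "\<tau>2 a - \<tau>2 c - \<rho> \<in> S2 (e + e + e)"
        using S2 unfolding almost_period_family_def by blast
      then have "\<tau>1 a - \<tau>1 c \<in> S2 (e + e + e)" by (simp add: \<rho>_def)
      then have "\<tau>1 a - \<tau>1 c \<in> S2 \<epsilon>"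
        by (rule almost_period_family_mono[OF S2]) (use \<open>e > 0\<close> in \<open>simp add: e_def\<close>)
      moreover have "\<tau>1 a - \<tau>1 c \<in> S1 (e + e)"
        using S1 \<tau>1(1) unfolding almost_period_family_def by blast
      then have "\<tau>1 a - \<tau>1 c \<in> S1 \<epsilon>"
        by (rule almost_period_family_mono[OF S1]) (use \<open>e > 0\<close> in \<open>simp add: e_def\<close>)
      moreover have "\<tau>1 a - \<tau>1 c \<in> {a'..a' + (l + 2 * C)}"
        using \<tau>1(2)[of a] C[of a] unfolding c_def[symmetric] by (auto simp: a_def abs_le_iff)
      ultimately show ?thesis by blast
    qed
    moreover have "l + 2 * C > 0" using \<open>C \<ge> 0\<close> \<open>l1 > 0\<close> by (simp add: l_def max_def)
    ultimately show ?thesis unfolding relatively_dense_def by blast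
  qed
  have nbhd: "\<exists>\<eta>>0. {-\<eta>..\<eta>} \<subseteq> S1 \<epsilon> \<inter> S2 \<epsilon>" if \<epsilon>: "\<epsilon> > 0" for \<epsilon>
  proof -
    obtain \<eta>1 where 1: "\<eta>1 > 0" "{-\<eta>1..\<eta>1} \<subseteq> S1 \<epsilon>"
      using S1 \<epsilon> unfolding almost_period_family_def by meson
    obtain \<eta>2 where 2: "\<eta>2 > 0" "{-\<eta>2..\<eta>2} \<subseteq> S2 \<epsilon>"
      using S2 \<epsilon> unfolding almost_period_family_def by meson
    have "{- min \<eta>1 \<eta>2..min \<eta>1 \<eta>2} \<subseteq> S1 \<epsilon> \<inter> S2 \<epsilon>"
      using 1(2) 2(2) by (intro Int_greatest order_trans[OF _ 1(2)] order_trans[OF _ 2(2)]) auto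
    then show ?thesis using 1(1) 2(1) by (intro exI[of _ "min \<eta>1 \<eta>2"]) simp
  qed
  show ?thesis
    using dense nbhd S1 S2 unfolding almost_period_family_def by blast
qed

text \<open>Small shifts are periods by uniform continuity. For differences, both increments are
  taken from the common base time t - \<sigma>, which is harmless since large |t| stays large after
  a shift.\<close>

lemma almost_period_family_remote_periods:
  fixes N :: "'v::euclidean_space \<Rightarrow> real" and f :: "real \<Rightarrow> 'p::metric_space \<Rightarrow> 'v"
  assumes N: "is_norm N" and f: "remotely_ap_uniformly N W f"
  shows "almost_period_family (remote_periods N W f)"
  unfolding almost_period_family_def
proof (intro conjI allI impI)
  fix \<epsilon> :: real assume "\<epsilon> > 0"
  show "relatively_dense (remote_periods N W f \<epsilon>)"
  proof (rule relatively_dense_mono)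
    show "relatively_dense
        {\<tau>. Limsup at_infinity (\<lambda>t. SUP x\<in>W. ereal (N (f (t + \<tau>) x - f t x))) < ereal \<epsilon>}"
      using f \<open>\<epsilon> > 0\<close> unfolding remotely_ap_uniformly_def by blast
    show "{\<tau>. Limsup at_infinity (\<lambda>t. SUP x\<in>W. ereal (N (f (t + \<tau>) x - f t x))) < ereal \<epsilon>}
        \<subseteq> remote_periods N W f \<epsilon>"
    proof
      fix \<tau>
      assume "\<tau> \<in> {\<tau>. Limsup at_infinity (\<lambda>t. SUP x\<in>W. ereal (N (f (t + \<tau>) x - f t x))) < ereal \<epsilon>}"
      then have "\<forall>\<^sub>F t in at_infinity. (SUP x\<in>W. ereal (N (f (t + \<tau>) x - f t x))) < ereal \<epsilon>"
        by (intro Limsup_lessD) simp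
      then have "\<forall>\<^sub>F t in at_infinity. \<forall>x\<in>W. N (f (t + \<tau>) x - f t x) < \<epsilon>"
      proof eventually_elim
        case (elim t)
        show ?case
        proof
          fix x assume "x \<in> W"
          then have "ereal (N (f (t + \<tau>) x - f t x)) \<le> (SUP x\<in>W. ereal (N (f (t + \<tau>) x - f t x)))"
            by (rule SUP_upper)
          from le_less_trans[OF this elim] show "N (f (t + \<tau>) x - f t x) < \<epsilon>" by simp
        qed
      qed
      then show "\<tau> \<in> remote_periods N W f \<epsilon>" by (simp add: remote_periods_def)
    qed
  qed
  obtain C where "C > 0" and C: "\<And>x. N x \<le> C * norm x" using is_norm_le_norm[OF N] by blast
  have "uniformly_continuous_on (UNIV \<times> W) (\<lambda>(t, x). f t x)"
    using f unfolding remotely_ap_uniformly_def by blast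
  moreover have "\<epsilon> / C > 0" using \<open>\<epsilon> > 0\<close> \<open>C > 0\<close> by simp
  ultimately obtain d where "d > 0"
    and d: "\<And>p q. p \<in> UNIV \<times> W \<Longrightarrow> q \<in> UNIV \<times> W \<Longrightarrow> dist q p < d
      \<Longrightarrow> dist ((\<lambda>(t, x). f t x) q) ((\<lambda>(t, x). f t x) p) < \<epsilon> / C"
    unfolding uniformly_continuous_on_def by meson
  have "\<tau> \<in> remote_periods N W f \<epsilon>" if \<tau>: "\<tau> \<in> {- (d / 2)..d / 2}" for \<tau>
  proof -
    have "N (f (t + \<tau>) x - f t x) < \<epsilon>" if "x \<in> W" for t x
    proof -
      have "dist (t + \<tau>, x) (t, x) < d" using \<tau> \<open>d > 0\<close> by (auto simp: dist_Pair_Pair dist_real_def abs_less_iff)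
      then have "norm (f (t + \<tau>) x - f t x) < \<epsilon> / C"
        using d[of "(t, x)" "(t + \<tau>, x)"] that by (simp add: dist_norm)
      then have "C * norm (f (t + \<tau>) x - f t x) < \<epsilon>" using \<open>C > 0\<close> by (simp add: field_simps)
      then show ?thesis using C[of "f (t + \<tau>) x - f t x"] by linarith
    qed
    then show ?thesis by (simp add: remote_periods_def)
  qed
  then show "\<exists>\<eta>>0. {-\<eta>..\<eta>} \<subseteq> remote_periods N W f \<epsilon>"
    using \<open>d > 0\<close> by (intro exI[of _ "d / 2"]) auto
next
  fix \<epsilon> \<delta> \<tau> \<sigma>
  assume \<tau>: "\<tau> \<in> remote_periods N W f \<epsilon>" and \<sigma>: "\<sigma> \<in> remote_periods N W f \<delta>"
  have "\<forall>\<^sub>F t in at_infinity. \<forall>x\<in>W. N (f (t - \<sigma> + \<tau>) x - f (t - \<sigma>) x) < \<epsilon>"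
    "\<forall>\<^sub>F t in at_infinity. \<forall>x\<in>W. N (f (t - \<sigma> + \<sigma>) x - f (t - \<sigma>) x) < \<delta>"
    using \<tau> \<sigma> unfolding remote_periods_def mem_Collect_eq
    by (auto dest: eventually_at_infinity_shift[where c = "- \<sigma>"])
  then have "\<forall>\<^sub>F t in at_infinity. \<forall>x\<in>W. N (f (t + (\<tau> - \<sigma>)) x - f t x) < \<epsilon> + \<delta>"
  proof eventually_elim
    case (elim t)
    show ?case
    proof
      fix x assume "x \<in> W"
      then show "N (f (t + (\<tau> - \<sigma>)) x - f t x) < \<epsilon> + \<delta>"
        using elim is_norm_triangle_via[OF N, of "f (t + (\<tau> - \<sigma>)) x" "f t x" "f (t - \<sigma>) x"]
          is_norm_minus_commute[OF N, of "f (t - \<sigma>) x" "f t x"]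
        by (fastforce simp: algebra_simps)
    qed
  qed
  then show "\<tau> - \<sigma> \<in> remote_periods N W f (\<epsilon> + \<delta>)" by (simp add: remote_periods_def)
qed

text \<open>A one-point parameter set lets \<open>A\<close> take part in the search for common
  periods.\<close>

lemma remotely_ap_imp_uniformly:
  fixes p :: "'p::metric_space"
  assumes "remotely_ap N u"
  shows "remotely_ap_uniformly N {p} (\<lambda>t _. u t)"
proof -
  have "(\<lambda>(t, x). u t) ` (UNIV \<times> {p}) = range u" by force
  moreover have "uniformly_continuous_on UNIV u"
    using assms unfolding remotely_ap_def by blast
  then have "uniformly_continuous_on (UNIV \<times> {p}) (\<lambda>(t, x). u t)"
    by (simp add: uniformly_continuous_on_def dist_Pair_Pair)
  ultimately show ?thesis
    using assms unfolding remotely_ap_def remotely_ap_uniformly_def by simp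
qed

subsection \<open>Perturbed systems\<close>

context dichotomic_system
begin

text \<open>Reciprocal of the bound for the map from the inhomogeneity to the bounded solution,
  hence the threshold below which a Lipschitz constant yields a contraction.\<close>

definition \<beta> :: real where "\<beta> = \<alpha> / (2 * K)"

lemma beta_pos: "\<beta> > 0"
  using alpha_pos K_pos by (simp add: \<beta>_def)

lemma mult_eq_divide_beta: "2 * K / \<alpha> * \<eta> = \<eta> / \<beta>"
  by (simp add: \<beta>_def)

text \<open>The supremum D of the solution satisfies D \<le> (\<epsilon> + L D)/\<beta>. It is
  finite by the a priori bound \<open>B\<close>, so the term with D can be absorbed on the
  left.\<close>

lemma bounded_solution_contraction:
  assumes x: "linear_solution h x" and B: "\<And>t. N (x t) \<le> B" and L: "0 \<le> L" "L < \<beta>"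
    and h: "\<And>t. N (h t) \<le> \<epsilon> + L * N (x t)"
  shows "N (x t) \<le> \<epsilon> / (\<beta> - L)"
proof -
  define D where "D = (SUP t. N (x t))"
  have le_D: "N (x t) \<le> D" for t
    unfolding D_def using B by (intro cSUP_upper bdd_aboveI2[where M=B]) auto
  have hD: "N (h t) \<le> \<epsilon> + L * D" for t
    using h[of t] mult_left_mono[OF le_D[of t] L(1)] by linarith
  have "N (x t) \<le> (\<epsilon> + L * D) / \<beta>" for t
    using bounded_solution_estimate[OF x B hD, of t] unfolding mult_eq_divide_beta .
  then have "D \<le> (\<epsilon> + L * D) / \<beta>" unfolding D_def by (intro cSUP_least) auto
  then have "D * \<beta> \<le> \<epsilon> + L * D" using beta_pos by (simp only: pos_le_divide_eq)
  then have "D * (\<beta> - L) \<le> \<epsilon>" by (simp add: algebra_simps)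
  then have "D \<le> \<epsilon> / (\<beta> - L)" using L by (simp only: pos_le_divide_eq diff_gt_0_iff_gt)
  then show ?thesis using le_D[of t] by linarith
qed

text \<open>For |t| \<ge> b + T the whole window around t lies where the inhomogeneity is
  small.\<close>

lemma eventually_estimate:
  assumes x: "linear_solution h x" and B: "\<And>t. N (x t) \<le> B" and "e > 0"
    and h: "\<forall>\<^sub>F t in at_infinity. N (h t) \<le> \<eta>"
  shows "\<forall>\<^sub>F t in at_infinity. N (x t) \<le> \<eta> / \<beta> + e"
proof -
  obtain b where b: "\<And>t. b \<le> \<bar>t\<bar> \<Longrightarrow> N (h t) \<le> \<eta>" using h by (auto simp: eventually_at_infinity)
  obtain T where T: "T > 0" "2 * K * exp (- \<alpha> * T) * B < e" using \<open>e > 0\<close> by (rule exp_decay_small)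
  have "N (x t) \<le> \<eta> / \<beta> + e" if t: "b + T \<le> \<bar>t\<bar>" for t
  proof -
    have "N (x t) \<le> 2 * K * exp (- \<alpha> * T) * B + 2 * K / \<alpha> * \<eta>"
      using t by (intro window_estimate[OF x T(1) b B B]) linarith
    then show ?thesis unfolding mult_eq_divide_beta using T(2) by linarith
  qed
  then show ?thesis unfolding eventually_at_infinity by auto
qed

text \<open>An eventual bound c for the solution improves to (\<epsilon> + L c)/\<beta> plus an
  arbitrarily small slack. This affine map has fixed point \<epsilon>/(\<beta> - L) and slope below
  1, so finitely many improvements come within \<delta> of the fixed point.\<close>

lemma eventually_contraction:
  assumes x: "linear_solution h x" and B: "\<And>t. N (x t) \<le> B" and L: "0 \<le> L" "L < \<beta>" and "\<epsilon> \<ge> 0"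
    and h: "\<forall>\<^sub>F t in at_infinity. N (h t) \<le> \<epsilon> + L * N (x t)" and "\<delta> > 0"
  shows "\<forall>\<^sub>F t in at_infinity. N (x t) \<le> \<epsilon> / (\<beta> - L) + \<delta>"
proof -
  define m where "m = \<epsilon> / (\<beta> - L)"
  define d where "d = \<delta> / 2"
  have "d > 0" using \<open>\<delta> > 0\<close> by (simp add: d_def)
  define q where "q = L / \<beta>"
  have "m \<ge> 0" using \<open>\<epsilon> \<ge> 0\<close> L unfolding m_def by (intro divide_nonneg_nonneg) auto
  have q: "0 \<le> q" "q < 1" using L beta_pos by (simp_all add: q_def)
  have m: "(\<epsilon> + L * c) / \<beta> = m + q * (c - m)" for c
  proof -
    have "\<epsilon> = m * (\<beta> - L)" using L by (simp add: m_def)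
    then show ?thesis using beta_pos by (simp add: q_def field_simps)
  qed
  have "\<forall>\<^sub>F t in at_infinity. N (x t) \<le> m + (q ^ k * B + d)" for k
  proof (induction k)
    case 0
    have "N (x t) \<le> m + (B + d)" for t using B[of t] \<open>m \<ge> 0\<close> \<open>d > 0\<close> by linarith
    then show ?case by simp
  next
    case (Suc k)
    let ?c = "m + (q ^ k * B + d)"
    have "\<forall>\<^sub>F t in at_infinity. N (h t) \<le> \<epsilon> + L * ?c"
      using h Suc
    proof eventually_elim
      case (elim t)
      then show ?case using mult_left_mono[OF elim(2) L(1)] by linarith
    qed
    \<comment> \<open>The slack (1 - q) d is chosen so that q d + (1 - q) d = d: the accumulated
      error does not grow with k.\<close>
    then have "\<forall>\<^sub>F t in at_infinity. N (x t) \<le> (\<epsilon> + L * ?c) / \<beta> + (1 - q) * d"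
      using q \<open>d > 0\<close> by (intro eventually_estimate[OF x B]) auto
    moreover have "(\<epsilon> + L * ?c) / \<beta> + (1 - q) * d = m + (q ^ Suc k * B + d)"
      unfolding m by (simp add: algebra_simps)
    ultimately show ?case by simp
  qed
  moreover have "\<exists>k. q ^ k * B < d"
  proof -
    have "(\<lambda>k. q ^ k * B) \<longlonglongrightarrow> 0" using q by (intro tendsto_mult_left_zero LIMSEQ_power_zero) auto
    then have "\<forall>\<^sub>F k in sequentially. q ^ k * B < d"
      using \<open>d > 0\<close> by (intro order_tendstoD(2)) auto
    then show ?thesis by (auto simp: eventually_sequentially)
  qed
  then obtain k where "q ^ k * B < d" by blast
  then have "m + (q ^ k * B + d) \<le> m + \<delta>" by (simp add: d_def)
  ultimately show ?thesis unfolding m_def[symmetric]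
    by (meson eventually_mono order_trans)
qed

text \<open>Picard iteration on the tube of radius \<open>r\<close>: the condition on \<gamma> makes
  the tube invariant, and L < \<beta> makes the map contract. The known solution has inhomogeneity
  \<open>h\<close>, so only the defect between \<open>F\<close> and \<open>h\<close> along it must
  be small.\<close>

lemma solution_near_exists:
  assumes \<xi>: "linear_solution h \<xi>" and \<xi>_bound: "\<And>t. N (\<xi> t) \<le> B" and H: "\<And>t. N (h t) \<le> H"
    and r: "r \<ge> 0" and L: "0 \<le> L" "L < \<beta>"
    and lipschitz: "\<And>t x y. N (x - \<xi> t) \<le> r \<Longrightarrow> N (y - \<xi> t) \<le> r \<Longrightarrow> N (F t x - F t y) \<le> L * N (x - y)"
    and continuous: "\<And>x. continuous_on UNIV x \<Longrightarrow> (\<And>t. N (x t - \<xi> t) \<le> r)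
      \<Longrightarrow> continuous_on UNIV (\<lambda>t. F t (x t))"
    and defect: "\<And>t. N (F t (\<xi> t) - h t) \<le> \<gamma>" and \<gamma>: "\<gamma> + L * r \<le> \<beta> * r"
  shows "\<exists>x. is_solution (\<lambda>t y. A t *v y + F t y) x \<and> (\<forall>t. N (x t - \<xi> t) \<le> r)"
proof -
  define X where "X = {x. continuous_on UNIV x \<and> (\<forall>t. N (x t - \<xi> t) \<le> r)}"
  have \<xi>X: "\<xi> \<in> X" using linear_solution_continuous[OF \<xi>] r by (simp add: X_def is_norm_zero[OF N])
  have XB: "N (x t) \<le> B + r" if "x \<in> X" for x t
  proof -
    have "N (x t - \<xi> t) \<le> r" using that by (simp add: X_def)
    then show ?thesis using is_norm_triangle_sub[OF N, of "x t" "\<xi> t"] \<xi>_bound[of t] by linarith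
  qed
  have "\<exists>y. y \<in> X \<and> linear_solution (\<lambda>t. F t (x t)) y" if x: "x \<in> X" for x
  proof -
    have near: "N (F t (x t) - h t) \<le> \<gamma> + L * r" for t
    proof -
      have d: "N (x t - \<xi> t) \<le> r" using x by (simp add: X_def)
      have "N (F t (x t) - F t (\<xi> t)) \<le> L * N (x t - \<xi> t)"
        using d r by (intro lipschitz) (simp_all add: is_norm_zero[OF N])
      also have "\<dots> \<le> L * r" using d L by (intro mult_left_mono)
      finally show ?thesis
        using defect[of t] is_norm_triangle_via[OF N, of "F t (x t)" "h t" "F t (\<xi> t)"] by linarith
    qed
    have "N (F t (x t)) \<le> H + (\<gamma> + L * r)" for t
      using near[of t] H[of t] is_norm_triangle_sub[OF N, of "F t (x t)" "h t"] by linarith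
    moreover have "continuous_on UNIV (\<lambda>t. F t (x t))" using x by (intro continuous) (auto simp: X_def)
    ultimately obtain y where y: "linear_solution (\<lambda>t. F t (x t)) y"
      and yB: "\<And>t. N (y t) \<le> 2 * K / \<alpha> * (H + (\<gamma> + L * r))"
      using bounded_solution_exists by meson
    have "N (y t - \<xi> t) \<le> (\<gamma> + L * r) / \<beta>" for t
      unfolding mult_eq_divide_beta[symmetric]
    proof (rule bounded_solution_estimate[OF linear_solution_diff[OF y \<xi>] _ near])
      show "N (y t - \<xi> t) \<le> 2 * K / \<alpha> * (H + (\<gamma> + L * r)) + B" for t
        using is_norm_triangle_diff[OF N, of "y t" "\<xi> t"] yB[of t] \<xi>_bound[of t] by linarith
    qed
    moreover have "(\<gamma> + L * r) / \<beta> \<le> r"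
      using \<gamma> beta_pos by (simp only: pos_divide_le_eq mult.commute[of r])
    ultimately have "y \<in> X"
      using linear_solution_continuous[OF y] by (auto simp: X_def intro: order_trans)
    then show ?thesis using y by blast
  qed
  then have "\<forall>x\<in>X. \<exists>y. y \<in> X \<and> linear_solution (\<lambda>t. F t (x t)) y" by blast
  \<comment> \<open>Any choice of solutions in the tube will do, because the contraction estimate
    holds for all bounded solutions.\<close>
  from bchoice[OF this] obtain T where TX: "\<And>x. x \<in> X \<Longrightarrow> T x \<in> X"
    and T: "\<And>x. x \<in> X \<Longrightarrow> linear_solution (\<lambda>t. F t (x t)) (T x)"
    by auto
  define q where "q = L / \<beta>"
  have q: "0 \<le> q" "q < 1"
    using L beta_pos by (simp_all add: q_def)
  have contraction: "N (T x t - T y t) \<le> q * D"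
    if x: "x \<in> X" and y: "y \<in> X" and D: "\<And>t. N (x t - y t) \<le> D" for x y t D
  proof -
    have "N (T x t - T y t) \<le> (L * D) / \<beta>"
      unfolding mult_eq_divide_beta[symmetric]
    proof (rule bounded_solution_estimate[OF linear_solution_diff[OF T[OF x] T[OF y]]])
      show "N (T x t - T y t) \<le> (B + r) + (B + r)" for t
        using is_norm_triangle_diff[OF N, of "T x t" "T y t"] XB[OF TX[OF x], of t] XB[OF TX[OF y], of t]
        by linarith
      show "N (F t (x t) - F t (y t)) \<le> L * D" for t
      proof -
        have "N (F t (x t) - F t (y t)) \<le> L * N (x t - y t)"
          using x y by (intro lipschitz) (auto simp: X_def)
        also have "\<dots> \<le> L * D" using D L by (intro mult_left_mono)
        finally show ?thesis .
      qed
    qed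
    then show ?thesis by (simp only: q_def times_divide_eq_left)
  qed
  define z where "z k = (T ^^ k) \<xi>" for k
  have zX: "z k \<in> X" for k by (induction k) (auto simp: z_def \<xi>X TX)
  have z_Suc: "z (Suc k) = T (z k)" for k by (simp add: z_def)
  have z_step: "N (z (Suc k) t - z k t) \<le> q ^ k * r" for k t
  proof (induction k arbitrary: t)
    case 0
    show ?case using TX[OF \<xi>X] by (simp add: z_def X_def)
  next
    case (Suc k)
    have "N (T (z (Suc k)) t - T (z k) t) \<le> q * (q ^ k * r)" by (intro contraction zX Suc)
    then show ?case by (simp add: z_Suc mult_ac)
  qed
  obtain c where "c > 0" and c: "\<And>v. norm v \<le> c * N v" using norm_le_is_norm[OF N] by blast
  obtain C where "C > 0" and C: "\<And>v. N v \<le> C * norm v" using is_norm_le_norm[OF N] by blast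
  \<comment> \<open>The increments are dominated by a geometric series, so their telescoping sums,
    which are the iterates minus \<xi>, converge uniformly.\<close>
  have "uniform_limit UNIV (\<lambda>n t. \<Sum>i<n. z (Suc i) t - z i t)
      (\<lambda>t. suminf (\<lambda>i. z (Suc i) t - z i t)) sequentially"
  proof (rule Weierstrass_m_test)
    show "norm (z (Suc k) t - z k t) \<le> c * (q ^ k * r)" for k t
      using c[of "z (Suc k) t - z k t"] mult_left_mono[OF z_step[of k t], of c] \<open>c > 0\<close> by linarith
    show "summable (\<lambda>k. c * (q ^ k * r))"
      using q by (intro summable_mult summable_mult2 summable_geometric) simp
  qed
  then have "uniform_limit UNIV (\<lambda>n t. (\<Sum>i<n. z (Suc i) t - z i t) + \<xi> t)
      (\<lambda>t. suminf (\<lambda>i. z (Suc i) t - z i t) + \<xi> t) sequentially"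
    by (intro uniform_limit_add uniform_limit_const)
  moreover have "(\<Sum>i<n. z (Suc i) t - z i t) + \<xi> t = z n t" for n t
    using sum_lessThan_telescope[of "\<lambda>i. z i t" n] by (simp add: z_def)
  ultimately obtain l where l: "uniform_limit UNIV z l sequentially" by auto
  have "continuous_on UNIV l"
    using zX by (intro uniform_limit_theorem[OF _ l]) (auto simp: X_def)
  moreover have "N (l t - \<xi> t) \<le> r" for t
  proof (rule tendsto_upperbound)
    have "(\<lambda>n. z n t - \<xi> t) \<longlonglongrightarrow> l t - \<xi> t"
      using tendsto_uniform_limitI[OF l, of t] by (intro tendsto_intros) auto
    then show "(\<lambda>n. N (z n t - \<xi> t)) \<longlonglongrightarrow> N (l t - \<xi> t)"
      using continuous_on_tendsto_compose[OF continuous_on_is_norm[OF N, of UNIV]] by fastforce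
    show "\<forall>\<^sub>F n in sequentially. N (z n t - \<xi> t) \<le> r" using zX by (simp add: X_def)
  qed simp
  ultimately have lX: "l \<in> X" by (simp add: X_def)
  have "T l t = l t" for t
  proof -
    have "N (T l t - l t) \<le> 0"
    proof (rule field_le_epsilon)
      fix e :: real assume "e > 0"
      then have "e / (2 * C) > 0" using \<open>C > 0\<close> by simp
      then obtain n where n: "\<And>m t. m \<ge> n \<Longrightarrow> dist (z m t) (l t) < e / (2 * C)"
        using l unfolding uniform_limit_sequentially_iff by blast
      have e: "N (z m t - l t) \<le> e / 2" if "m \<ge> n" for m t
        using C[of "z m t - l t"] n[OF that, of t] \<open>C > 0\<close> by (simp add: dist_norm field_simps)
      then have "N (l t - z n t) \<le> e / 2" for t by (simp add: is_norm_minus_commute[OF N, of "l t"])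
      from contraction[OF lX zX this] have "N (T l t - z (Suc n) t) \<le> q * (e / 2)" by (simp add: z_Suc)
      also have "\<dots> \<le> 1 * (e / 2)" using q \<open>e > 0\<close> by (intro mult_right_mono) auto
      finally show "N (T l t - l t) \<le> 0 + e"
        using e[of "Suc n" t] is_norm_triangle_via[OF N, of "T l t" "l t" "z (Suc n) t"] by simp
    qed
    then show ?thesis
      using is_norm_nonneg[OF N, of "T l t - l t"] is_norm_eq_0[OF N, of "T l t - l t"] by simp
  qed
  then have "T l = l" by (rule ext)
  then have "is_solution (\<lambda>t y. A t *v y + F t y) l" using T[OF lX] by (simp add: is_solution_def)
  then show ?thesis using lX by (auto simp: X_def)
qed

text \<open>The increment \<open>x(t + \<tau>) - x(t)\<close> solves a linear equation with the same \<open>A\<close> and, for a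
  common remote almost period \<open>\<tau>\<close> of \<open>A\<close> and \<open>F\<close>, an eventually small inhomogeneity up to a contraction.\<close>

lemma bounded_solution_remotely_ap:
  assumes x: "is_solution (\<lambda>t y. A t *v y + F t y) x" and R: "\<And>t. N (x t) \<le> R"
    and L: "0 \<le> L" "L < \<beta>"
    and lipschitz: "\<And>t y y'. N y \<le> R \<Longrightarrow> N y' \<le> R \<Longrightarrow> N (F t y - F t y') \<le> L * N (y - y')"
    and a: "\<And>t. matrix_norm N (A t) \<le> a" and H: "\<And>t. N (F t (x t)) \<le> H"
    and periods: "\<And>\<epsilon>. \<epsilon> > 0 \<Longrightarrow> relatively_dense {\<tau>. \<forall>\<^sub>F t in at_infinity.
      matrix_norm N (A (t + \<tau>) - A t) < \<epsilon> \<and> (\<forall>y. N y \<le> R \<longrightarrow> N (F (t + \<tau>) y - F t y) < \<epsilon>)}"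
  shows "remotely_ap N x"
  unfolding remotely_ap_def
proof (intro conjI allI impI)
  show "bounded (range x)" unfolding bounded_iff_is_norm[OF N] using R by blast
  have "R \<ge> 0" using R[of 0] is_norm_nonneg[OF N, of "x 0"] by linarith
  have "a \<ge> 0" using a[of 0] is_norm_nonneg[OF is_norm_matrix_norm[OF N], of "A 0"] by linarith
  have "H \<ge> 0" using H[of 0] is_norm_nonneg[OF N, of "F 0 (x 0)"] by linarith
  have deriv: "(x has_vector_derivative A t *v x t + F t (x t)) (at t)" for t
    using x unfolding is_solution_def by blast
  have dB: "N (A t *v x t + F t (x t)) \<le> a * R + H" for t
  proof -
    have "N (A t *v x t) \<le> matrix_norm N (A t) * N (x t)" by (rule matrix_norm_bound[OF N])
    also have "\<dots> \<le> a * R" using a R \<open>a \<ge> 0\<close> is_norm_nonneg[OF N] by (intro mult_mono) auto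
    finally show ?thesis using H[of t] is_norm_triangle[OF N, of "A t *v x t" "F t (x t)"] by linarith
  qed
  obtain c where "c > 0" and c: "\<And>v. norm v \<le> c * N v" using norm_le_is_norm[OF N] by blast
  have inc: "norm (x t - x s) \<le> c * (a * R + H) * (t - s)" if "s \<le> t" for s t
  proof -
    have "N (x t - x s) \<le> (a * R + H) * t - (a * R + H) * s"
      using that
    proof (rule is_norm_increment_le[OF N])
      fix u
      show "((\<lambda>u. (a * R + H) * u) has_real_derivative (a * R + H)) (at u)"
        by (auto intro!: derivative_eq_intros)
    qed (rule deriv dB)+
    then have "c * N (x t - x s) \<le> c * ((a * R + H) * t - (a * R + H) * s)"
      using \<open>c > 0\<close> by (intro mult_left_mono) auto
    then show ?thesis using c[of "x t - x s"] by (simp add: algebra_simps)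
  qed
  have "(c * (a * R + H))-lipschitz_on UNIV x"
  proof (rule lipschitz_onI)
    show "0 \<le> c * (a * R + H)" using \<open>c > 0\<close> \<open>a \<ge> 0\<close> \<open>R \<ge> 0\<close> \<open>H \<ge> 0\<close> by simp
    show "dist (x t) (x s) \<le> c * (a * R + H) * dist t s" for s t
      using inc[of s t] inc[of t s]
      by (cases "s \<le> t") (auto simp: dist_norm dist_real_def norm_minus_commute)
  qed
  then show "uniformly_continuous_on UNIV x" by (rule lipschitz_on_uniformly_continuous)
  fix \<epsilon> :: real assume "\<epsilon> > 0"
  \<comment> \<open>The matrix increment contributes e R and the increment of \<open>F\<close>
    contributes e, so division by \<beta> - L gives \<epsilon>/3. Another \<epsilon>/3 is the slack
    of \<open>eventually_contraction\<close>; the sum stays strictly below \<epsilon>, as the Limsup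
    demands.\<close>
  define e where "e = \<epsilon> / 3 * (\<beta> - L) / (R + 1)"
  have bL: "\<beta> - L > 0" using L by linarith
  have "e > 0" unfolding e_def using \<open>\<epsilon> > 0\<close> bL \<open>R \<ge> 0\<close> by (intro divide_pos_pos mult_pos_pos) auto
  show "relatively_dense {\<tau>. Limsup at_infinity (\<lambda>t. ereal (N (x (t + \<tau>) - x t))) < ereal \<epsilon>}"
  proof (rule relatively_dense_mono[OF periods[OF \<open>e > 0\<close>]], rule subsetI, unfold mem_Collect_eq)
    fix \<tau>
    assume \<tau>: "\<forall>\<^sub>F t in at_infinity.
      matrix_norm N (A (t + \<tau>) - A t) < e \<and> (\<forall>y. N y \<le> R \<longrightarrow> N (F (t + \<tau>) y - F t y) < e)"
    let ?w = "\<lambda>t. x (t + \<tau>) - x t"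
    \<comment> \<open>The change of the matrix is moved into the inhomogeneity so that the linear
      part remains \<open>A t\<close>, to which the dichotomy applies.\<close>
    let ?h = "\<lambda>t. (A (t + \<tau>) - A t) *v x (t + \<tau>) + (F (t + \<tau>) (x (t + \<tau>)) - F t (x t))"
    have w: "linear_solution ?h ?w"
      unfolding is_solution_def
    proof
      fix t
      have "((\<lambda>s. s + \<tau>) has_vector_derivative 1) (at t)"
        by (auto intro!: derivative_eq_intros)
      from vector_diff_chain_at[OF this deriv[of "t + \<tau>"]]
      have "((\<lambda>t. x (t + \<tau>)) has_vector_derivative
          A (t + \<tau>) *v x (t + \<tau>) + F (t + \<tau>) (x (t + \<tau>))) (at t)"
        by (simp add: o_def)
      from has_vector_derivative_diff[OF this deriv[of t]]
      show "(?w has_vector_derivative A t *v ?w t + ?h t) (at t)"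
        by (simp add: matrix_vector_mult_diff_distrib matrix_vector_mult_diff_rdistrib algebra_simps)
    qed
    have wB: "N (?w t) \<le> R + R" for t
      using is_norm_triangle_diff[OF N, of "x (t + \<tau>)" "x t"] R[of t] R[of "t + \<tau>"] by linarith
    have "\<forall>\<^sub>F t in at_infinity. N (?h t) \<le> e * (R + 1) + L * N (?w t)"
      using \<tau>
    proof eventually_elim
      case (elim t)
      have "N ((A (t + \<tau>) - A t) *v x (t + \<tau>)) \<le> matrix_norm N (A (t + \<tau>) - A t) * N (x (t + \<tau>))"
        by (rule matrix_norm_bound[OF N])
      also have "\<dots> \<le> e * R"
        using elim R \<open>e > 0\<close> is_norm_nonneg[OF N] by (intro mult_mono) auto
      finally have 1: "N ((A (t + \<tau>) - A t) *v x (t + \<tau>)) \<le> e * R" .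
      have 2: "N (F (t + \<tau>) (x (t + \<tau>)) - F t (x (t + \<tau>))) < e" using elim R by blast
      have 3: "N (F t (x (t + \<tau>)) - F t (x t)) \<le> L * N (?w t)" by (intro lipschitz R)
      show ?case
        using 1 2 3 is_norm_triangle[OF N, of "(A (t + \<tau>) - A t) *v x (t + \<tau>)"
            "F (t + \<tau>) (x (t + \<tau>)) - F t (x t)"]
          is_norm_triangle_via[OF N, of "F (t + \<tau>) (x (t + \<tau>))" "F t (x t)" "F t (x (t + \<tau>))"]
        by (simp add: distrib_left)
    qed
    then have "\<forall>\<^sub>F t in at_infinity. N (?w t) \<le> e * (R + 1) / (\<beta> - L) + \<epsilon> / 3"
      using \<open>e > 0\<close> \<open>R \<ge> 0\<close> \<open>\<epsilon> > 0\<close> by (intro eventually_contraction[OF w wB L]) auto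
    moreover have "e * (R + 1) / (\<beta> - L) = \<epsilon> / 3"
    proof -
      have "R + 1 \<noteq> 0" using \<open>R \<ge> 0\<close> by linarith
      then have "e * (R + 1) = \<epsilon> / 3 * (\<beta> - L)" unfolding e_def by (rule nonzero_eq_divide_eq[THEN iffD1]) simp
      then show ?thesis using bL by simp
    qed
    ultimately have "\<forall>\<^sub>F t in at_infinity. ereal (N (?w t)) \<le> ereal (2 * \<epsilon> / 3)" by simp
    then have "Limsup at_infinity (\<lambda>t. ereal (N (?w t))) \<le> ereal (2 * \<epsilon> / 3)" by (rule Limsup_bounded)
    also have "\<dots> < ereal \<epsilon>" using \<open>\<epsilon> > 0\<close> by simp
    finally show "Limsup at_infinity (\<lambda>t. ereal (N (?w t))) < ereal \<epsilon>" .
  qed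
qed

end

theorem theorem2p1:
  fixes N :: "real^'n \<Rightarrow> real"
    and A \<Phi> :: "real \<Rightarrow> real^'n^'n"
    and P :: "real^'n^'n"
    and \<alpha> K \<nu>\<^sub>m :: real
    and f :: "real \<Rightarrow> real^'n \<Rightarrow> real^'n"
    and Df :: "real \<Rightarrow> real^'n \<Rightarrow> real^'n^'n"
    and D2f :: "real \<Rightarrow> real^'n \<Rightarrow> ((real^'n) \<Rightarrow>\<^sub>L (real^'n^'n))"
    and g :: "real \<Rightarrow> real^'n \<Rightarrow> real \<Rightarrow> real^'n"
    and M :: "real \<Rightarrow> real"
    and M1 :: "real \<Rightarrow> real \<Rightarrow> real"
    and \<xi> :: "real \<Rightarrow> real^'n"
  assumes norm: "is_norm N"
    and nu_m: "\<nu>\<^sub>m > 0"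
    and g_0: "\<And>t x. g t x 0 = 0"
    \<comment> \<open>hypothesis (1)\<close>
    and A_rap: "remotely_ap (matrix_norm N) A"
    and fundamental: "is_fundamental_matrix A \<Phi>"
    and dichotomy: "exponential_dichotomy N \<Phi> \<alpha> K P"
    and green: "integrable_bi_remotely_ap N (green_kernel \<Phi> P)"
    \<comment> \<open>hypothesis (2)\<close>
    and f_rap: "\<And>W. compact W \<Longrightarrow> remotely_ap_uniformly N W f"
    and M_bounds: "\<And>r. r > 0 \<Longrightarrow> 0 < M r \<and> M r < \<alpha> / (2 * K)"
    and f_lipschitz: "\<And>r t x y. \<lbrakk>r > 0; N x \<le> r; N y \<le> r\<rbrakk>
          \<Longrightarrow> N (f t x - f t y) \<le> M r * N (x - y)"
    \<comment> \<open>hypothesis (3)\<close>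
    and xi_rap: "remotely_ap N \<xi>"
    and xi_solution: "is_solution (\<lambda>t y. A t *v y + f t y) \<xi>"
    and xi_unique: "\<And>y. \<lbrakk>remotely_ap N y; is_solution (\<lambda>t y. A t *v y + f t y) y\<rbrakk> \<Longrightarrow> y = \<xi>"
    and Df: "\<And>t x. (f t has_derivative (\<lambda>h. Df t x *v h)) (at x)"
    and D2f: "\<And>t x. (Df t has_derivative blinfun_apply (D2f t x)) (at x)"
    and D2f_continuous: "\<And>t. continuous_on UNIV (D2f t)"
    and D2f_lipschitz: "\<And>t. local_lipschitz {t} UNIV D2f"
    and Df_xi_rap: "remotely_ap (matrix_norm N) (\<lambda>t. Df t (\<xi> t))"
    and delta: "(SUP t. matrix_norm N (Df t (\<xi> t))) < \<alpha> / (4 * K\<^sup>2)"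
    \<comment> \<open>hypothesis (4)\<close>
    and g_rap: "\<And>r. r > 0 \<Longrightarrow>
          remotely_ap_uniformly N ({x. N x < r} \<times> {0..\<nu>\<^sub>m}) (\<lambda>t (x, \<nu>). g t x \<nu>)"
    and g_bounded: "\<exists>\<nu>\<^sub>1\<in>{0<..\<nu>\<^sub>m}. \<forall>\<nu>\<in>{0..\<nu>\<^sub>1}. \<exists>C. \<forall>t x. N (g t x \<nu>) \<le> C"
    and g_lipschitz: "\<And>r \<nu> t x y. \<lbrakk>r > 0; \<nu> \<in> {0..\<nu>\<^sub>m}; N x \<le> r; N y \<le> r\<rbrakk>
          \<Longrightarrow> N (g t x \<nu> - g t y \<nu>) \<le> M1 r \<nu> * N (x - y)"
    and g_small: "\<And>r. r > 0 \<Longrightarrow>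
          ((\<lambda>\<nu>. SUP (t, x)\<in>UNIV \<times> {x. N x \<le> r}. N (g t x \<nu>)) \<longlongrightarrow> 0) (at_right 0)"
    and M1_small: "\<And>r. r > 0 \<Longrightarrow> (M1 r \<longlongrightarrow> 0) (at_right 0)"
  shows "\<exists>r>0. \<exists>\<nu>\<^sub>0\<in>{0<..\<nu>\<^sub>m}. \<exists>\<psi> :: real \<Rightarrow> real \<Rightarrow> real^'n.
           (\<forall>\<nu>\<in>{0..\<nu>\<^sub>0}.
              (remotely_ap N (\<psi> \<nu>) \<and>
               is_solution (\<lambda>t x. A t *v x + f t x + g t x \<nu>) (\<psi> \<nu>) \<and>
               (SUP t. N (\<psi> \<nu> t - \<xi> t)) \<le> r) \<and>
              (\<forall>\<phi>. remotely_ap N \<phi> \<and>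
                   is_solution (\<lambda>t x. A t *v x + f t x + g t x \<nu>) \<phi> \<and>
                   (SUP t. N (\<phi> t - \<xi> t)) \<le> r \<longrightarrow> \<phi> = \<psi> \<nu>)) \<and>
           (uniformly_continuous_on (UNIV \<times> {x. N x \<le> r} \<times> {0..\<nu>\<^sub>0}) (\<lambda>(t, x, \<nu>). g t x \<nu>) \<longrightarrow>
              (\<forall>t. continuous_on {0..\<nu>\<^sub>0} (\<lambda>\<nu>. \<psi> \<nu> t) \<and>
                   ((\<lambda>\<nu>. \<psi> \<nu> t) \<longlongrightarrow> \<xi> t) (at_right 0)))"
proof -
  interpret dichotomic_system N A \<Phi> P \<alpha> K
    using norm fundamental dichotomy by unfold_locales
  let ?W = "\<lambda>R. {x. N x < R} \<times> {0..\<nu>\<^sub>m}"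
  obtain B where B: "\<And>t. N (\<xi> t) \<le> B"
    using xi_rap unfolding remotely_ap_def bounded_iff_is_norm[OF N] by blast
  have "B \<ge> 0" using B[of 0] is_norm_nonneg[OF N, of "\<xi> 0"] by linarith
  \<comment> \<open>The ball of radius R contains the unit tube around \<xi>.\<close>
  define R where "R = B + 1"
  have "R > 0" using \<open>B \<ge> 0\<close> by (simp add: R_def)
  \<comment> \<open>Bounds both the size and the Lipschitz constant of g. With this choice m + L =
    \<beta> exactly, which is the invariance condition for radius 1.\<close>
  define m where "m = (\<beta> - M R) / 2"
  define L where "L = M R + m"
  have "0 < M R" "M R < \<beta>" using M_bounds[OF \<open>R > 0\<close>] by (simp_all add: \<beta>_def)
  then have "m > 0" and L: "0 \<le> L" "L < \<beta>" and m: "m + L * 1 \<le> \<beta> * 1"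
    by (simp_all add: L_def m_def field_simps)

  have f_unif: "remotely_ap_uniformly N {x. N x \<le> R} f"
    by (rule f_rap[OF compact_is_norm_cball[OF N]])
  \<comment> \<open>The hypothesis on g concerns open balls; radius R + 1 covers the closed ball of
    radius R.\<close>
  have g_unif: "remotely_ap_uniformly N (?W (R + 1)) (\<lambda>t (x, \<nu>). g t x \<nu>)"
    using \<open>R > 0\<close> by (intro g_rap) simp
  obtain H where H: "\<forall>v\<in>(\<lambda>(t, x). f t x) ` (UNIV \<times> {x. N x \<le> R}). N v \<le> H"
    using f_unif unfolding remotely_ap_uniformly_def bounded_iff_is_norm[OF N] by blast
  have f_le: "N (f t x) \<le> H" if "N x \<le> R" for t x
    using that by (intro bspec[OF H] image_eqI[where x = "(t, x)"]) auto
  obtain G where G: "\<forall>v\<in>(\<lambda>(t, p). case p of (x, \<nu>) \<Rightarrow> g t x \<nu>) ` (UNIV \<times> ?W (R + 1)). N v \<le> G"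
    using g_unif unfolding remotely_ap_uniformly_def bounded_iff_is_norm[OF N] by blast
  have g_le_G: "N (g t x \<nu>) \<le> G" if "N x \<le> R" "\<nu> \<in> {0..\<nu>\<^sub>m}" for t x \<nu>
    using that by (intro bspec[OF G] image_eqI[where x = "(t, x, \<nu>)"]) auto
  obtain a where a: "\<And>t. matrix_norm N (A t) \<le> a"
    using A_rap unfolding remotely_ap_def bounded_iff_is_norm[OF is_norm_matrix_norm[OF N]] by blast

  have "\<forall>\<^sub>F \<nu> in at_right 0. M1 R \<nu> < m \<and> (SUP (t, x)\<in>UNIV \<times> {x. N x \<le> R}. N (g t x \<nu>)) < m"
    using \<open>m > 0\<close> \<open>R > 0\<close> by (intro eventually_conj order_tendstoD(2)[OF M1_small]
        order_tendstoD(2)[OF g_small]) auto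
  then obtain b where "b > 0" and b: "\<And>\<nu>. 0 < \<nu> \<Longrightarrow> \<nu> < b \<Longrightarrow> M1 R \<nu> < m"
    "\<And>\<nu>. 0 < \<nu> \<Longrightarrow> \<nu> < b \<Longrightarrow> (SUP (t, x)\<in>UNIV \<times> {x. N x \<le> R}. N (g t x \<nu>)) < m"
    unfolding eventually_at_right_field by blast
  define \<nu>0 where "\<nu>0 = min \<nu>\<^sub>m (b / 2)"
  have \<nu>0: "\<nu>0 \<in> {0<..\<nu>\<^sub>m}" "\<nu>0 < b" using nu_m \<open>b > 0\<close> by (auto simp: \<nu>0_def)
  \<comment> \<open>The limits are taken from the right and say nothing at \<nu> = 0, where
    \<open>g_0\<close> is used instead.\<close>
  have g_le: "N (g t x \<nu>) \<le> m" if "\<nu> \<in> {0..\<nu>0}" "N x \<le> R" for t x \<nu>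
  proof (cases "\<nu> = 0")
    case False
    have "N (g t x \<nu>) \<le> (SUP (t, x)\<in>UNIV \<times> {x. N x \<le> R}. N (g t x \<nu>))"
      using that \<nu>0 g_le_G by (intro cSUP_upper2[where x = "(t, x)"] bdd_aboveI2[where M = G]) auto
    then show ?thesis using b(2)[of \<nu>] that \<nu>0 False by auto
  qed (use \<open>m > 0\<close> in \<open>simp add: g_0 is_norm_zero[OF N]\<close>)
  have g_lip: "N (g t x \<nu> - g t y \<nu>) \<le> m * N (x - y)"
    if "\<nu> \<in> {0..\<nu>0}" "N x \<le> R" "N y \<le> R" for t x y \<nu>
  proof (cases "\<nu> = 0")
    case False
    have "N (g t x \<nu> - g t y \<nu>) \<le> M1 R \<nu> * N (x - y)"
      using that \<nu>0 \<open>R > 0\<close> by (intro g_lipschitz) auto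
    also have "\<dots> \<le> m * N (x - y)"
      using b(1)[of \<nu>] that \<nu>0 False by (intro mult_right_mono is_norm_nonneg[OF N]) auto
    finally show ?thesis .
  qed (use \<open>m > 0\<close> in \<open>simp add: g_0 is_norm_zero[OF N] is_norm_nonneg[OF N]\<close>)

  define F where "F \<nu> t x = f t x + g t x \<nu>" for \<nu> t x
  have sol_iff: "is_solution (\<lambda>t x. A t *v x + f t x + g t x \<nu>) x
      \<longleftrightarrow> is_solution (\<lambda>t y. A t *v y + F \<nu> t y) x" for \<nu> x
    by (simp add: F_def add.assoc)
  have F_lip: "N (F \<nu> t x - F \<nu> t y) \<le> L * N (x - y)"
    if "\<nu> \<in> {0..\<nu>0}" "N x \<le> R" "N y \<le> R" for \<nu> t x y
  proof -
    have "F \<nu> t x - F \<nu> t y = (f t x - f t y) + (g t x \<nu> - g t y \<nu>)" by (simp add: F_def)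
    then show ?thesis
      using is_norm_triangle[OF N, of "f t x - f t y" "g t x \<nu> - g t y \<nu>"]
        f_lipschitz[OF \<open>R > 0\<close> that(2,3), of t] g_lip[OF that, of t]
      by (simp add: L_def distrib_right)
  qed
  have F_le: "N (F \<nu> t x) \<le> H + m" if "\<nu> \<in> {0..\<nu>0}" "N x \<le> R" for \<nu> t x
    unfolding F_def using is_norm_triangle[OF N, of "f t x" "g t x \<nu>"] f_le[OF that(2)] g_le[OF that]
    by (meson add_mono order_trans)
  have near: "N x \<le> R" if "N (x - \<xi> t) \<le> 1" for x t
    using is_norm_triangle_sub[OF N, of x "\<xi> t"] B[of t] that by (simp add: R_def)
  have F_cont: "continuous_on UNIV (\<lambda>t. F \<nu> t (x t))"
    if "\<nu> \<in> {0..\<nu>0}" "continuous_on UNIV x" "\<And>t. N (x t) \<le> R" for \<nu> x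
  proof -
    have "continuous_on (UNIV \<times> {x. N x \<le> R}) (\<lambda>(t, x). f t x)"
      using f_unif unfolding remotely_ap_uniformly_def
      by (intro uniformly_continuous_imp_continuous) auto
    moreover have "continuous_on UNIV (\<lambda>t. (t, x t))" by (intro continuous_intros that(2))
    moreover have "range (\<lambda>t. (t, x t)) \<subseteq> UNIV \<times> {x. N x \<le> R}" using that(3) by auto
    ultimately have "continuous_on UNIV (\<lambda>t. case (t, x t) of (t, x) \<Rightarrow> f t x)"
      by (rule continuous_on_compose2)
    then have 1: "continuous_on UNIV (\<lambda>t. f t (x t))" by simp
    have lt: "N (x t) < R + 1" for t using that(3)[of t] by linarith
    have "continuous_on (UNIV \<times> ?W (R + 1)) (\<lambda>(t, x, \<nu>). g t x \<nu>)"
      using g_unif unfolding remotely_ap_uniformly_def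
      by (intro uniformly_continuous_imp_continuous) auto
    moreover have "continuous_on UNIV (\<lambda>t. (t, x t, \<nu>))" by (intro continuous_intros that(2))
    moreover have "range (\<lambda>t. (t, x t, \<nu>)) \<subseteq> UNIV \<times> ?W (R + 1)" using that(1) \<nu>0 lt by auto
    ultimately have "continuous_on UNIV (\<lambda>t. case (t, x t, \<nu>) of (t, x, \<nu>) \<Rightarrow> g t x \<nu>)"
      by (rule continuous_on_compose2)
    then have "continuous_on UNIV (\<lambda>t. g t (x t) \<nu>)" by simp
    then show ?thesis unfolding F_def using 1 by (intro continuous_on_add)
  qed

  have stability: "N (x t - y t) \<le> e / (\<beta> - L)"
    if \<nu>: "\<nu> \<in> {0..\<nu>0}" "\<mu> \<in> {0..\<nu>0}"
      and x: "is_solution (\<lambda>t y. A t *v y + F \<nu> t y) x" "\<And>t. N (x t) \<le> R"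
      and y: "is_solution (\<lambda>t y. A t *v y + F \<mu> t y) y" "\<And>t. N (y t) \<le> R"
      and e: "\<And>t z. N z \<le> R \<Longrightarrow> N (g t z \<nu> - g t z \<mu>) \<le> e" for x y \<nu> \<mu> e t
  proof (rule bounded_solution_contraction[OF linear_solution_diff _ L])
    show "linear_solution (\<lambda>t. F \<nu> t (x t)) x" "linear_solution (\<lambda>t. F \<mu> t (y t)) y"
      using x(1) y(1) by (simp_all add: is_solution_def)
    show "N (x t - y t) \<le> R + R" for t
      using is_norm_triangle_diff[OF N, of "x t" "y t"] x(2)[of t] y(2)[of t] by linarith
    show "N (F \<nu> t (x t) - F \<mu> t (y t)) \<le> e + L * N (x t - y t)" for t
    proof -
      have "F \<nu> t (y t) - F \<mu> t (y t) = g t (y t) \<nu> - g t (y t) \<mu>" by (simp add: F_def)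
      then show ?thesis
        using is_norm_triangle_via[OF N, of "F \<nu> t (x t)" "F \<mu> t (y t)" "F \<nu> t (y t)"]
          F_lip[OF \<nu>(1) x(2)[of t] y(2)[of t], of t] e[OF y(2)[of t], of t] by simp
    qed
  qed

  have rap: "remotely_ap N x"
    if \<nu>: "\<nu> \<in> {0..\<nu>0}" and x: "is_solution (\<lambda>t y. A t *v y + F \<nu> t y) x" "\<And>t. N (x t) \<le> R"
    for x \<nu>
  proof (rule bounded_solution_remotely_ap[OF x L F_lip[OF \<nu>] a F_le[OF \<nu> x(2)]])
    fix \<epsilon> :: real assume "\<epsilon> > 0"
    define S where "S e = remote_periods (matrix_norm N) {0::real} (\<lambda>t _. A t) e \<inter>
      (remote_periods N {x. N x \<le> R} f e \<inter> remote_periods N (?W (R + 1)) (\<lambda>t (x, \<nu>). g t x \<nu>) e)"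
      for e
    have "almost_period_family S"
      unfolding S_def
      by (intro almost_period_family_Int almost_period_family_remote_periods is_norm_matrix_norm N
          remotely_ap_imp_uniformly A_rap f_unif g_unif)
    \<comment> \<open>Half the tolerance, since the increments of f and g add up in
      \<open>F\<close>.\<close>
    then have dense: "relatively_dense (S (\<epsilon> / 2))"
      using \<open>\<epsilon> > 0\<close> by (simp add: almost_period_family_def)
    show "relatively_dense {\<tau>. \<forall>\<^sub>F t in at_infinity. matrix_norm N (A (t + \<tau>) - A t) < \<epsilon> \<and>
        (\<forall>y. N y \<le> R \<longrightarrow> N (F \<nu> (t + \<tau>) y - F \<nu> t y) < \<epsilon>)}"
    proof (rule relatively_dense_mono[OF dense], rule subsetI, unfold mem_Collect_eq)
      fix \<tau> assume "\<tau> \<in> S (\<epsilon> / 2)"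
      then have "\<forall>\<^sub>F t in at_infinity. matrix_norm N (A (t + \<tau>) - A t) < \<epsilon> / 2"
        "\<forall>\<^sub>F t in at_infinity. \<forall>y\<in>{x. N x \<le> R}. N (f (t + \<tau>) y - f t y) < \<epsilon> / 2"
        "\<forall>\<^sub>F t in at_infinity. \<forall>p\<in>?W (R + 1).
           N ((case p of (x, \<nu>) \<Rightarrow> g (t + \<tau>) x \<nu>) - (case p of (x, \<nu>) \<Rightarrow> g t x \<nu>)) < \<epsilon> / 2"
        by (simp_all add: S_def remote_periods_def)
      then show "\<forall>\<^sub>F t in at_infinity. matrix_norm N (A (t + \<tau>) - A t) < \<epsilon> \<and>
        (\<forall>y. N y \<le> R \<longrightarrow> N (F \<nu> (t + \<tau>) y - F \<nu> t y) < \<epsilon>)"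
      proof eventually_elim
        case (elim t)
        have "N (F \<nu> (t + \<tau>) y - F \<nu> t y) < \<epsilon>" if y: "N y \<le> R" for y
        proof -
          have "F \<nu> (t + \<tau>) y - F \<nu> t y
              = (f (t + \<tau>) y - f t y) + (g (t + \<tau>) y \<nu> - g t y \<nu>)" by (simp add: F_def)
          moreover have "N (f (t + \<tau>) y - f t y) < \<epsilon> / 2" using elim(2) y by blast
          moreover have "(y, \<nu>) \<in> ?W (R + 1)" using y \<nu> \<nu>0 by auto
          from bspec[OF elim(3) this] have "N (g (t + \<tau>) y \<nu> - g t y \<nu>) < \<epsilon> / 2" by simp
          ultimately show ?thesis
            using is_norm_triangle[OF N, of "f (t + \<tau>) y - f t y" "g (t + \<tau>) y \<nu> - g t y \<nu>"]
            by simp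
        qed
        moreover have "matrix_norm N (A (t + \<tau>) - A t) < \<epsilon>" using elim(1) \<open>\<epsilon> > 0\<close> by linarith
        ultimately show ?case by blast
      qed
    qed
  qed

  have "\<exists>x. is_solution (\<lambda>t y. A t *v y + F \<nu> t y) x \<and> (\<forall>t. N (x t - \<xi> t) \<le> 1)"
    if \<nu>: "\<nu> \<in> {0..\<nu>0}" for \<nu>
  proof (rule solution_near_exists[OF _ B _ _ L _ _ _ m])
    show "linear_solution (\<lambda>t. f t (\<xi> t)) \<xi>" using xi_solution by (simp add: is_solution_def)
    have "N (\<xi> t) \<le> R" for t using B[of t] by (simp add: R_def)
    then show "N (f t (\<xi> t)) \<le> H" "N (F \<nu> t (\<xi> t) - f t (\<xi> t)) \<le> m" for t
      using f_le g_le[OF \<nu>] by (simp_all add: F_def)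
    show "N (F \<nu> t x - F \<nu> t y) \<le> L * N (x - y)" if "N (x - \<xi> t) \<le> 1" "N (y - \<xi> t) \<le> 1" for t x y
      using that by (intro F_lip[OF \<nu>] near)
    show "continuous_on UNIV (\<lambda>t. F \<nu> t (x t))"
      if "continuous_on UNIV x" "\<And>t. N (x t - \<xi> t) \<le> 1" for x
      using that by (intro F_cont[OF \<nu>] near)
  qed simp
  then have "\<forall>\<nu>\<in>{0..\<nu>0}. \<exists>x. is_solution (\<lambda>t y. A t *v y + F \<nu> t y) x \<and> (\<forall>t. N (x t - \<xi> t) \<le> 1)"
    by blast
  from bchoice[OF this] obtain \<psi> where
    \<psi>: "\<And>\<nu>. \<nu> \<in> {0..\<nu>0} \<Longrightarrow> is_solution (\<lambda>t y. A t *v y + F \<nu> t y) (\<psi> \<nu>)"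
    and \<psi>_near: "\<And>\<nu> t. \<nu> \<in> {0..\<nu>0} \<Longrightarrow> N (\<psi> \<nu> t - \<xi> t) \<le> 1" by blast
  have \<psi>R: "N (\<psi> \<nu> t) \<le> R" if "\<nu> \<in> {0..\<nu>0}" for \<nu> t
    using that by (intro near[of _ t] \<psi>_near)
  have \<psi>_rap: "remotely_ap N (\<psi> \<nu>)" if "\<nu> \<in> {0..\<nu>0}" for \<nu>
    by (rule rap[OF that \<psi>[OF that] \<psi>R[OF that]])

  have unique: "\<phi> = \<psi> \<nu>"
    if \<nu>: "\<nu> \<in> {0..\<nu>0}" and \<phi>: "remotely_ap N \<phi>" "is_solution (\<lambda>t y. A t *v y + F \<nu> t y) \<phi>"
      "(SUP t. N (\<phi> t - \<xi> t)) \<le> 1" for \<nu> \<phi>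
  proof
    fix t
    obtain C where C: "\<And>t. N (\<phi> t) \<le> C"
      using \<phi>(1) unfolding remotely_ap_def bounded_iff_is_norm[OF N] by blast
    \<comment> \<open>A bound on a real supremum yields pointwise bounds only for a set known to be
      bounded above; here boundedness comes from remote almost periodicity.\<close>
    have "N (\<phi> t - \<xi> t) \<le> C + B" for t
      using is_norm_triangle_diff[OF N, of "\<phi> t" "\<xi> t"] C[of t] B[of t] by linarith
    then have "N (\<phi> t - \<xi> t) \<le> (SUP t. N (\<phi> t - \<xi> t))" for t
      by (intro cSUP_upper bdd_aboveI2[where M = "C + B"]) auto
    then have "N (\<phi> t - \<xi> t) \<le> 1" for t using \<phi>(3) order_trans by blast
    then have "N (\<phi> t) \<le> R" for t by (rule near)
    then have "N (\<phi> t - \<psi> \<nu> t) \<le> 0 / (\<beta> - L)"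
      by (intro stability[OF \<nu> \<nu> \<phi>(2) _ \<psi>[OF \<nu>] \<psi>R[OF \<nu>]]) (simp_all add: is_norm_zero[OF N])
    then show "\<phi> t = \<psi> \<nu> t"
      using is_norm_nonneg[OF N, of "\<phi> t - \<psi> \<nu> t"] is_norm_eq_0[OF N, of "\<phi> t - \<psi> \<nu> t"] by simp
  qed

  have cont: "continuous_on {0..\<nu>0} (\<lambda>\<nu>. \<psi> \<nu> t)" for t
    unfolding continuous_on_iff
  proof (intro ballI allI impI)
    fix \<nu> e :: real
    assume \<nu>: "\<nu> \<in> {0..\<nu>0}" and "e > 0"
    obtain c where "c > 0" and c: "\<And>v. norm v \<le> c * N v" using norm_le_is_norm[OF N] by blast
    obtain C where "C > 0" and C: "\<And>v. N v \<le> C * norm v" using is_norm_le_norm[OF N] by blast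
    \<comment> \<open>C passes from the Euclidean norm to \<open>N\<close> and c passes back;
      together with the factor 1/(\<beta> - L) of \<open>stability\<close> the final distance is at
      most e/2.\<close>
    define e' where "e' = e / (2 * c) * (\<beta> - L) / C"
    have "e' > 0" using \<open>e > 0\<close> \<open>c > 0\<close> \<open>C > 0\<close> L by (simp add: e'_def)
    moreover have "uniformly_continuous_on (UNIV \<times> ?W (R + 1)) (\<lambda>(t, x, \<nu>). g t x \<nu>)"
      using g_unif unfolding remotely_ap_uniformly_def by blast
    ultimately obtain d where "d > 0" and d: "\<And>p q. p \<in> UNIV \<times> ?W (R + 1) \<Longrightarrow>
        q \<in> UNIV \<times> ?W (R + 1) \<Longrightarrow> dist q p < d \<Longrightarrow>
        dist ((\<lambda>(t, x, \<nu>). g t x \<nu>) q) ((\<lambda>(t, x, \<nu>). g t x \<nu>) p) < e'"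
      unfolding uniformly_continuous_on_def by meson
    have "dist (\<psi> \<mu> t) (\<psi> \<nu> t) < e" if \<mu>: "\<mu> \<in> {0..\<nu>0}" and "dist \<mu> \<nu> < d" for \<mu>
    proof -
      have "N (g s z \<mu> - g s z \<nu>) \<le> C * e'" if "N z \<le> R" for s z
      proof -
        have "norm (g s z \<mu> - g s z \<nu>) < e'"
          using d[of "(s, z, \<nu>)" "(s, z, \<mu>)"] \<open>dist \<mu> \<nu> < d\<close> that \<nu> \<mu> \<nu>0
          by (simp add: dist_Pair_Pair dist_norm)
        then have "C * norm (g s z \<mu> - g s z \<nu>) \<le> C * e'" using \<open>C > 0\<close> by simp
        then show ?thesis using C[of "g s z \<mu> - g s z \<nu>"] by linarith
      qed
      then have "N (\<psi> \<mu> t - \<psi> \<nu> t) \<le> C * e' / (\<beta> - L)"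
        by (intro stability[OF \<mu> \<nu> \<psi>[OF \<mu>] \<psi>R[OF \<mu>] \<psi>[OF \<nu>] \<psi>R[OF \<nu>]])
      also have "\<dots> = e / (2 * c)" using \<open>C > 0\<close> L by (simp add: e'_def)
      finally have "c * N (\<psi> \<mu> t - \<psi> \<nu> t) \<le> e / 2" using \<open>c > 0\<close> by (simp add: field_simps)
      then show ?thesis using c[of "\<psi> \<mu> t - \<psi> \<nu> t"] \<open>e > 0\<close> by (simp add: dist_norm)
    qed
    then show "\<exists>d>0. \<forall>\<mu>\<in>{0..\<nu>0}. dist \<mu> \<nu> < d \<longrightarrow> dist (\<psi> \<mu> t) (\<psi> \<nu> t) < e"
      using \<open>d > 0\<close> by blast
  qed

  have "0 \<in> {0..\<nu>0}" using \<nu>0 by simp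
  \<comment> \<open>At \<nu> = 0 the perturbation vanishes, so uniqueness of \<xi> applies and the
    limit becomes continuity at 0.\<close>
  have "\<psi> 0 = \<xi>"
    using \<psi>[OF \<open>0 \<in> {0..\<nu>0}\<close>]
    by (intro xi_unique \<psi>_rap[OF \<open>0 \<in> {0..\<nu>0}\<close>]) (simp add: F_def g_0)
  then have lim: "((\<lambda>\<nu>. \<psi> \<nu> t) \<longlongrightarrow> \<xi> t) (at_right 0)" for t
    using cont[of t] \<open>0 \<in> {0..\<nu>0}\<close> \<nu>0 unfolding continuous_on_def
    by (metis at_within_Icc_at_right greaterThanAtMost_iff)

  show ?thesis
  proof (intro exI[of _ 1] conjI bexI[of _ \<nu>0] exI[of _ \<psi>] ballI allI impI)
    show "(SUP t. N (\<psi> \<nu> t - \<xi> t)) \<le> 1" if "\<nu> \<in> {0..\<nu>0}" for \<nu>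
      using \<psi>_near[OF that] by (intro cSUP_least) auto
  qed (use \<psi>_rap \<psi> unique cont lim \<nu>0 in \<open>auto simp only: sol_iff zero_less_one\<close>)
qed

end
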